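(* The $C^*$-algebras $Q(\boldsymbol{\infty})$ and $Q_b^{vv}(M_\infty)$ are isomorphic.
   Context: $M_\infty$ denotes the $C^*$-algebra of compact operators on a separable infinite-dimensional Hilbert space. $B(\boldsymbol{\infty})$ is the $C^*$-algebra of all bounded sequences $(m_1,m_2,\ldots)$ with $m_i\in M_\infty$ and $\lim_{i\to\infty}\|m_{i+1}-m_i\|=0$; $I(\boldsymbol{\infty})$ is the ideal of sequences converging to zero in norm; $Q(\boldsymbol{\infty})=B(\boldsymbol{\infty})/I(\boldsymbol{\infty})$. $C_b([0,\infty),M_\infty)$ (resp. $C_0([0,\infty),M_\infty)$) is the $C^*$-algebra of bounded norm-continuous (resp. continuous and vanishing at infinity) $M_\infty$-valued functions on $[0,\infty)$. For $[a,b]\subset[0,\infty)$ put $\mathrm{Var}_{a,b}f=\sup_{t_1,t_2\in[a,b]}\|f(t_2)-f(t_1)\|$. Let $C_b^{vv}([0,\infty),M_\infty)=\{f\in C_b([0,\infty),M_\infty):\lim_{t\to\infty}\mathrm{Var}_{a+t,b+t}f=0\}$; this is a $C^*$-subalgebra not depending on the choice of $a<b$. Finally $Q_b^{vv}(M_\infty)=C_b^{vv}([0,\infty),M_\infty)/C_0([0,\infty),M_\infty)$. *)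

theory Defs
  imports "HOL-Analysis.Analysis"
begin

section \<open>Complex Hilbert spaces\<close>

text \<open>The inner product is linear in the first argument.\<close>

class complex_hilbert_space = banach +
  fixes scaleC :: "complex \<Rightarrow> 'a \<Rightarrow> 'a" (infixr "*\<^sub>C" 75)
    and cinner :: "'a \<Rightarrow> 'a \<Rightarrow> complex"
  assumes scaleC_add_right: "c *\<^sub>C (x + y) = c *\<^sub>C x + c *\<^sub>C y"
    and scaleC_add_left: "(c + d) *\<^sub>C x = c *\<^sub>C x + d *\<^sub>C x"
    and scaleC_scaleC: "c *\<^sub>C d *\<^sub>C x = (c * d) *\<^sub>C x"
    and scaleR_scaleC: "r *\<^sub>R x = complex_of_real r *\<^sub>C x"
    and cinner_commute: "cinner x y = cnj (cinner y x)"
    and cinner_add_left: "cinner (x + y) z = cinner x z + cinner y z"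
    and cinner_scaleC_left: "cinner (c *\<^sub>C x) y = c * cinner x y"
    and cinner_same: "cinner x x = complex_of_real ((norm x)\<^sup>2)"

lemma scaleC_module: "module (scaleC :: complex \<Rightarrow> 'h::complex_hilbert_space \<Rightarrow> 'h)"
proof
  show "1 *\<^sub>C x = x" for x :: 'h
    using scaleR_scaleC[of 1 x] by simp
qed (simp_all add: scaleC_add_right scaleC_add_left scaleC_scaleC)

lemma norm_scaleC: "norm (c *\<^sub>C (x :: 'h::complex_hilbert_space)) = cmod c * norm x"
proof -
  have right: "cinner z (c *\<^sub>C x) = cnj c * cinner z x" for z
    by (metis cinner_commute cinner_scaleC_left complex_cnj_mult)
  have "complex_of_real ((norm (c *\<^sub>C x))\<^sup>2) = (c * cnj c) * cinner x x"
    unfolding cinner_same[symmetric] right cinner_scaleC_left by (simp add: mult_ac)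
  also have "\<dots> = complex_of_real ((cmod c * norm x)\<^sup>2)"
    by (simp only: cinner_same complex_norm_square[symmetric] of_real_mult[symmetric]
        power_mult_distrib)
  finally have "(norm (c *\<^sub>C x))\<^sup>2 = (cmod c * norm x)\<^sup>2"
    unfolding of_real_eq_iff .
  then show ?thesis by simp
qed

text \<open>Dimension is taken over the complex scalars.\<close>

definition infinite_dimensional :: "'h::complex_hilbert_space itself \<Rightarrow> bool" where
  "infinite_dimensional _ \<longleftrightarrow>
     \<not> (\<exists>S :: 'h set. finite S \<and> module.span scaleC S = UNIV)"

definition separable :: "'h::complex_hilbert_space itself \<Rightarrow> bool" where
  "separable _ \<longleftrightarrow> (\<exists>D :: 'h set. countable D \<and> closure D = UNIV)"


section \<open>Compact operators\<close>

text \<open>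
  The type of bounded real-linear maps carries the operator norm; the complex-linear
  operators are singled out inside it.
\<close>

definition compact_ops :: "('h::complex_hilbert_space \<Rightarrow>\<^sub>L 'h) set" where
  "compact_ops = {T. (\<forall>c x. blinfun_apply T (c *\<^sub>C x) = c *\<^sub>C blinfun_apply T x) \<and>
                     compact (closure (blinfun_apply T ` cball 0 1))}"

definition op_scale :: "complex \<Rightarrow> ('h::complex_hilbert_space \<Rightarrow>\<^sub>L 'h) \<Rightarrow> ('h \<Rightarrow>\<^sub>L 'h)" where
  "op_scale c T = Blinfun (\<lambda>x. c *\<^sub>C blinfun_apply T x)"

lemma op_scale_apply: "blinfun_apply (op_scale c T) x = c *\<^sub>C blinfun_apply T x"
proof -
  have "bounded_linear (\<lambda>x. c *\<^sub>C blinfun_apply T x)"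
  proof (rule bounded_linear_intro)
    show "c *\<^sub>C blinfun_apply T (x + y) = c *\<^sub>C blinfun_apply T x + c *\<^sub>C blinfun_apply T y" for x y
      by (simp add: blinfun.add_right scaleC_add_right)
    show "c *\<^sub>C blinfun_apply T (r *\<^sub>R x) = r *\<^sub>R c *\<^sub>C blinfun_apply T x" for r x
      unfolding blinfun.scaleR_right by (simp add: scaleR_scaleC scaleC_scaleC mult.commute)
    show "norm (c *\<^sub>C blinfun_apply T x) \<le> norm x * (cmod c * norm T)" for x
      using mult_left_mono[OF norm_blinfun[of T x], of "cmod c"]
      by (simp add: norm_scaleC mult_ac)
  qed
  then show ?thesis
    unfolding op_scale_def by (simp add: bounded_linear_Blinfun_apply)
qed

definition op_adjoint :: "('h::complex_hilbert_space \<Rightarrow>\<^sub>L 'h) \<Rightarrow> ('h \<Rightarrow>\<^sub>L 'h)" where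
  "op_adjoint T = (THE S. \<forall>x y. cinner (blinfun_apply T x) y = cinner x (blinfun_apply S y))"


section \<open>C*-algebras given by a carrier and operations; quotients; isomorphism\<close>

record 'a cstar_struct =
  cs_carrier :: "'a set"
  cs_add :: "'a \<Rightarrow> 'a \<Rightarrow> 'a"
  cs_mult :: "'a \<Rightarrow> 'a \<Rightarrow> 'a"
  cs_scale :: "complex \<Rightarrow> 'a \<Rightarrow> 'a"
  cs_star :: "'a \<Rightarrow> 'a"
  cs_norm :: "'a \<Rightarrow> real"

definition cs_coset :: "'a cstar_struct \<Rightarrow> 'a set \<Rightarrow> 'a \<Rightarrow> 'a set" where
  "cs_coset A I x = {cs_add A x j |j. j \<in> I}"

text \<open>The quotient by an ideal, whose elements are cosets, with the quotient norm.\<close>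

definition cs_quotient :: "'a cstar_struct \<Rightarrow> 'a set \<Rightarrow> 'a set cstar_struct" where
  "cs_quotient A I =
    \<lparr> cs_carrier = cs_coset A I ` cs_carrier A,
      cs_add = (\<lambda>X Y. \<Union>x\<in>X. \<Union>y\<in>Y. cs_coset A I (cs_add A x y)),
      cs_mult = (\<lambda>X Y. \<Union>x\<in>X. \<Union>y\<in>Y. cs_coset A I (cs_mult A x y)),
      cs_scale = (\<lambda>c X. \<Union>x\<in>X. cs_coset A I (cs_scale A c x)),
      cs_star = (\<lambda>X. \<Union>x\<in>X. cs_coset A I (cs_star A x)),
      cs_norm = (\<lambda>X. INF x\<in>X. cs_norm A x) \<rparr>"

text \<open>
  Isometry is automatic for *-isomorphisms of C*-algebras; it is listed because the norm
  is part of the structure.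
\<close>

definition cstar_iso :: "'a cstar_struct \<Rightarrow> 'b cstar_struct \<Rightarrow> ('a \<Rightarrow> 'b) \<Rightarrow> bool" where
  "cstar_iso A B \<phi> \<longleftrightarrow>
     bij_betw \<phi> (cs_carrier A) (cs_carrier B) \<and>
     (\<forall>x\<in>cs_carrier A. \<forall>y\<in>cs_carrier A.
        \<phi> (cs_add A x y) = cs_add B (\<phi> x) (\<phi> y) \<and>
        \<phi> (cs_mult A x y) = cs_mult B (\<phi> x) (\<phi> y)) \<and>
     (\<forall>x\<in>cs_carrier A.
        (\<forall>c. \<phi> (cs_scale A c x) = cs_scale B c (\<phi> x)) \<and>
        \<phi> (cs_star A x) = cs_star B (\<phi> x) \<and>
        cs_norm B (\<phi> x) = cs_norm A x)"

definition cstar_isomorphic :: "'a cstar_struct \<Rightarrow> 'b cstar_struct \<Rightarrow> bool" where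
  "cstar_isomorphic A B \<longleftrightarrow> (\<exists>\<phi>. cstar_iso A B \<phi>)"


section \<open>Algebras of operator-valued functions\<close>

text \<open>
  Pointwise operations and the supremum norm on a set \<open>F\<close> of operator-valued functions
  with domain \<open>S\<close>. Functions on \<open>S\<close> are represented as elements of \<^term>\<open>extensional S\<close>.
\<close>

definition fun_algebra ::
  "'i set \<Rightarrow> ('i \<Rightarrow> ('h::complex_hilbert_space \<Rightarrow>\<^sub>L 'h)) set \<Rightarrow> ('i \<Rightarrow> ('h \<Rightarrow>\<^sub>L 'h)) cstar_struct"
where
  "fun_algebra S F =
    \<lparr> cs_carrier = F,
      cs_add = (\<lambda>f g. \<lambda>s\<in>S. f s + g s),
      cs_mult = (\<lambda>f g. \<lambda>s\<in>S. f s o\<^sub>L g s),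
      cs_scale = (\<lambda>c f. \<lambda>s\<in>S. op_scale c (f s)),
      cs_star = (\<lambda>f. \<lambda>s\<in>S. op_adjoint (f s)),
      cs_norm = (\<lambda>f. SUP s\<in>S. norm (f s)) \<rparr>"

text \<open>Sequences are indexed from 0.\<close>

definition B_infty :: "(nat \<Rightarrow> ('h::complex_hilbert_space \<Rightarrow>\<^sub>L 'h)) set" where
  "B_infty = {m. range m \<subseteq> compact_ops \<and> bounded (range m) \<and>
                 (\<lambda>i. norm (m (Suc i) - m i)) \<longlonglongrightarrow> 0}"

definition I_infty :: "(nat \<Rightarrow> ('h::complex_hilbert_space \<Rightarrow>\<^sub>L 'h)) set" where
  "I_infty = {m \<in> B_infty. (\<lambda>i. norm (m i)) \<longlonglongrightarrow> 0}"

definition Q_infty :: "(nat \<Rightarrow> ('h::complex_hilbert_space \<Rightarrow>\<^sub>L 'h)) set cstar_struct" where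
  "Q_infty = cs_quotient (fun_algebra UNIV B_infty) I_infty"

definition C_b :: "(real \<Rightarrow> ('h::complex_hilbert_space \<Rightarrow>\<^sub>L 'h)) set" where
  "C_b = {f \<in> {0..} \<rightarrow>\<^sub>E compact_ops. continuous_on {0..} f \<and> bounded (f ` {0..})}"

definition C_0 :: "(real \<Rightarrow> ('h::complex_hilbert_space \<Rightarrow>\<^sub>L 'h)) set" where
  "C_0 = {f \<in> {0..} \<rightarrow>\<^sub>E compact_ops. continuous_on {0..} f \<and> ((\<lambda>t. norm (f t)) \<longlongrightarrow> 0) at_top}"

definition Var :: "real \<Rightarrow> real \<Rightarrow> (real \<Rightarrow> ('h::complex_hilbert_space \<Rightarrow>\<^sub>L 'h)) \<Rightarrow> real" where
  "Var a b f = (SUP (t1, t2)\<in>{a..b} \<times> {a..b}. norm (f t2 - f t1))"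

definition C_b_vv :: "real \<Rightarrow> real \<Rightarrow> (real \<Rightarrow> ('h::complex_hilbert_space \<Rightarrow>\<^sub>L 'h)) set" where
  "C_b_vv a b = {f \<in> C_b. ((\<lambda>t. Var (a + t) (b + t) f) \<longlongrightarrow> 0) at_top}"

definition Q_b_vv ::
  "real \<Rightarrow> real \<Rightarrow> (real \<Rightarrow> ('h::complex_hilbert_space \<Rightarrow>\<^sub>L 'h)) set cstar_struct" where
  "Q_b_vv a b = cs_quotient (fun_algebra {0..} (C_b_vv a b)) C_0"

end

theory Submission
  imports Defs
begin

text \<open>
  A function \<open>f\<close> of vanishing variation is sampled at the integers, and the sequence
  \<open>(f 0, f 1, \<dots>)\<close> determines \<open>f\<close> up to a function vanishing at infinity.
  Vanishing variation over windows of one fixed length means that \<open>f (u + s) - f u\<close> tends to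
  zero as \<open>u\<close> grows, uniformly for \<open>s\<close> in any bounded interval: a long step is a fixed
  number of short ones (\<open>C_b_vv_iff\<close>). Applied with steps of length at most one, this says
  that consecutive samples approach each other, so that \<open>sample\<close> maps \<open>C_b_vv a b\<close> into
  \<open>B_infty\<close>, and that \<open>f t\<close> is close to the sample at the integer part of \<open>t\<close>, so that
  the samples tend to zero exactly when \<open>f\<close> does (\<open>C_0_iff_sample_null\<close>). Hence the
  *-homomorphism \<open>sample\<close> induces an injection of the quotients. Piecewise linear
  interpolation lifts every sequence in \<open>B_infty\<close> to a function in \<open>C_b_vv a b\<close>
  (\<open>interpolate_C_b_vv\<close>), so the injection is onto. As interpolated values are convex
  combinations of samples, the lift preserves the supremum norm, whereas sampling does not
  increase it; so the two quotient norms agree.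

  The operations must stay inside the two algebras. For the involution this needs the
  existence of adjoints, which comes from the Riesz representation theorem, and the
  compactness of the adjoint of a compact operator (\<open>compact_ops_adjoint\<close>).
\<close>

section \<open>Isomorphisms of quotients\<close>

text \<open>
  The isomorphism sends a coset \<open>X\<close> in \<open>A\<close> to its preimage under \<open>\<rho>\<close>. The quotient operations are
  unions of cosets over all representatives, and taking preimages commutes with unions; so
  compatibility reduces to single cosets, where it is the assumption \<open>coset\<close>: this says
  that \<open>\<rho>\<close> induces an injective map of the quotients. The quotient norms agree because
  \<open>\<rho>\<close> contracts and each element of \<open>A\<close> has a lift that is no longer than itself.
\<close>

lemma cstar_isomorphic_quotients:
  fixes A :: "'a cstar_struct" and B :: "'b cstar_struct" and \<rho> :: "'b \<Rightarrow> 'a"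
  assumes maps: "\<And>f. f \<in> cs_carrier B \<Longrightarrow> \<rho> f \<in> cs_carrier A"
    and add: "\<And>f g. f \<in> cs_carrier B \<Longrightarrow> g \<in> cs_carrier B \<Longrightarrow>
      cs_add B f g \<in> cs_carrier B \<and> \<rho> (cs_add B f g) = cs_add A (\<rho> f) (\<rho> g)"
    and mult: "\<And>f g. f \<in> cs_carrier B \<Longrightarrow> g \<in> cs_carrier B \<Longrightarrow>
      cs_mult B f g \<in> cs_carrier B \<and> \<rho> (cs_mult B f g) = cs_mult A (\<rho> f) (\<rho> g)"
    and scale: "\<And>c f. f \<in> cs_carrier B \<Longrightarrow>
      cs_scale B c f \<in> cs_carrier B \<and> \<rho> (cs_scale B c f) = cs_scale A c (\<rho> f)"
    and star: "\<And>f. f \<in> cs_carrier B \<Longrightarrow>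
      cs_star B f \<in> cs_carrier B \<and> \<rho> (cs_star B f) = cs_star A (\<rho> f)"
    and nonneg: "\<And>x. x \<in> cs_carrier A \<Longrightarrow> 0 \<le> cs_norm A x"
    and contract: "\<And>f. f \<in> cs_carrier B \<Longrightarrow> cs_norm A (\<rho> f) \<le> cs_norm B f"
    and lift: "\<And>x. x \<in> cs_carrier A \<Longrightarrow>
      \<exists>f\<in>cs_carrier B. \<rho> f = x \<and> cs_norm B f \<le> cs_norm A x"
    and sub: "I \<subseteq> cs_carrier A"
    and coset: "\<And>h. h \<in> cs_carrier B \<Longrightarrow>
      {f \<in> cs_carrier B. \<rho> f \<in> cs_coset A I (\<rho> h)} = cs_coset B J h"
  shows "cstar_isomorphic (cs_quotient A I) (cs_quotient B J)"
proof -
  define \<phi> where "\<phi> X = {f \<in> cs_carrier B. \<rho> f \<in> X}" for X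
  have onto: "\<exists>f\<in>cs_carrier B. \<rho> f = x" if "x \<in> cs_carrier A" for x
    using lift[OF that] by blast
  have in_carrier: "X \<subseteq> cs_carrier A" if "X \<in> cs_coset A I ` cs_carrier A" for X
  proof
    fix y assume "y \<in> X"
    with that obtain x i where "x \<in> cs_carrier A" "i \<in> cs_carrier A" "y = cs_add A x i"
      using sub unfolding cs_coset_def by blast
    then show "y \<in> cs_carrier A"
      by (metis add maps onto)
  qed
  have \<phi>_coset: "\<phi> (cs_coset A I (\<rho> h)) = cs_coset B J h" if "h \<in> cs_carrier B" for h
    using coset[OF that] by (simp add: \<phi>_def)
  \<comment> \<open>As \<open>\<rho>\<close> is onto, the union over \<open>x \<in> X\<close> can be indexed by the lifts of the \<open>x\<close>.\<close>
  have \<phi>_UN: "\<phi> (\<Union>x\<in>X. F x) = (\<Union>f\<in>\<phi> X. \<phi> (F (\<rho> f)))" if "X \<subseteq> cs_carrier A" for X F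
    using that onto unfolding \<phi>_def by blast
  have \<phi>_binary: "\<phi> (\<Union>x\<in>X. \<Union>y\<in>Y. cs_coset A I (p x y))
      = (\<Union>f\<in>\<phi> X. \<Union>g\<in>\<phi> Y. cs_coset B J (q f g))"
    if "X \<subseteq> cs_carrier A" "Y \<subseteq> cs_carrier A"
      and pq: "\<And>f g. f \<in> cs_carrier B \<Longrightarrow> g \<in> cs_carrier B \<Longrightarrow>
        q f g \<in> cs_carrier B \<and> \<rho> (q f g) = p (\<rho> f) (\<rho> g)" for X Y p q
  proof -
    have "\<phi> (cs_coset A I (p (\<rho> f) (\<rho> g))) = cs_coset B J (q f g)"
      if "f \<in> \<phi> X" "g \<in> \<phi> Y" for f g
      using that pq[of f g] \<phi>_coset[of "q f g"] by (simp add: \<phi>_def)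
    then show ?thesis
      by (simp add: \<phi>_UN that)
  qed
  have \<phi>_unary: "\<phi> (\<Union>x\<in>X. cs_coset A I (p x)) = (\<Union>f\<in>\<phi> X. cs_coset B J (q f))"
    if "X \<subseteq> cs_carrier A"
      and pq: "\<And>f. f \<in> cs_carrier B \<Longrightarrow> q f \<in> cs_carrier B \<and> \<rho> (q f) = p (\<rho> f)" for X p q
  proof -
    have "\<phi> (cs_coset A I (p (\<rho> f))) = cs_coset B J (q f)" if "f \<in> \<phi> X" for f
      using that pq[of f] \<phi>_coset[of "q f"] by (simp add: \<phi>_def)
    then show ?thesis
      by (simp add: \<phi>_UN that)
  qed
  have "inj_on \<phi> (cs_coset A I ` cs_carrier A)"
  proof (rule inj_onI)
    fix X Y assume X: "X \<in> cs_coset A I ` cs_carrier A" and Y: "Y \<in> cs_coset A I ` cs_carrier A"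
      and eq: "\<phi> X = \<phi> Y"
    have "Z = \<rho> ` \<phi> Z" if "Z \<subseteq> cs_carrier A" for Z
      using that onto unfolding \<phi>_def by blast
    then show "X = Y"
      using eq in_carrier[OF X] in_carrier[OF Y] by metis
  qed
  moreover have "\<phi> ` cs_coset A I ` cs_carrier A = cs_coset B J ` cs_carrier B"
  proof -
    have "cs_carrier A = \<rho> ` cs_carrier B"
      using maps onto by blast
    then show ?thesis
      by (simp add: image_image \<phi>_coset)
  qed
  ultimately have bij: "bij_betw \<phi> (cs_coset A I ` cs_carrier A) (cs_coset B J ` cs_carrier B)"
    by (simp add: bij_betw_def)
  have norm: "(INF f\<in>\<phi> X. cs_norm B f) = (INF x\<in>X. cs_norm A x)" if X: "X \<subseteq> cs_carrier A" for X
  proof (cases "X = {}")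
    case True
    then show ?thesis by (simp add: \<phi>_def)
  next
    case False
    have bddA: "bdd_below (cs_norm A ` X)"
      using X nonneg by (intro bdd_belowI2[of _ 0]) blast
    have bddB: "bdd_below (cs_norm B ` \<phi> X)"
      using nonneg maps contract
      by (intro bdd_belowI2[of _ 0]) (force simp: \<phi>_def intro: order_trans)
    have "\<phi> X \<noteq> {}"
      using False X onto unfolding \<phi>_def by blast
    show ?thesis
    proof (rule antisym)
      show "(INF f\<in>\<phi> X. cs_norm B f) \<le> (INF x\<in>X. cs_norm A x)"
      proof (rule cINF_greatest[OF False])
        fix x assume "x \<in> X"
        then obtain f where "f \<in> \<phi> X" "cs_norm B f \<le> cs_norm A x"
          using lift[of x] X unfolding \<phi>_def by blast
        then show "(INF f\<in>\<phi> X. cs_norm B f) \<le> cs_norm A x"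
          using cINF_lower[OF bddB] order_trans by blast
      qed
      show "(INF x\<in>X. cs_norm A x) \<le> (INF f\<in>\<phi> X. cs_norm B f)"
      proof (rule cINF_greatest[OF \<open>\<phi> X \<noteq> {}\<close>])
        fix f assume "f \<in> \<phi> X"
        then show "(INF x\<in>X. cs_norm A x) \<le> cs_norm B f"
          using cINF_lower[OF bddA, of "\<rho> f"] contract[of f] by (auto simp: \<phi>_def)
      qed
    qed
  qed
  have "cstar_iso (cs_quotient A I) (cs_quotient B J) \<phi>"
    unfolding cstar_iso_def cs_quotient_def cstar_struct.simps
  proof (intro conjI ballI allI)
    fix X Y c assume X: "X \<in> cs_coset A I ` cs_carrier A" and Y: "Y \<in> cs_coset A I ` cs_carrier A"
    note carriers = in_carrier[OF X] in_carrier[OF Y]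
    show "\<phi> (\<Union>x\<in>X. \<Union>y\<in>Y. cs_coset A I (cs_add A x y))
        = (\<Union>x\<in>\<phi> X. \<Union>y\<in>\<phi> Y. cs_coset B J (cs_add B x y))"
      by (intro \<phi>_binary carriers add)
    show "\<phi> (\<Union>x\<in>X. \<Union>y\<in>Y. cs_coset A I (cs_mult A x y))
        = (\<Union>x\<in>\<phi> X. \<Union>y\<in>\<phi> Y. cs_coset B J (cs_mult B x y))"
      by (intro \<phi>_binary carriers mult)
  next
    fix X c assume X: "X \<in> cs_coset A I ` cs_carrier A"
    show "\<phi> (\<Union>x\<in>X. cs_coset A I (cs_scale A c x)) = (\<Union>x\<in>\<phi> X. cs_coset B J (cs_scale B c x))"
      by (intro \<phi>_unary in_carrier X scale)
    show "\<phi> (\<Union>x\<in>X. cs_coset A I (cs_star A x)) = (\<Union>x\<in>\<phi> X. cs_coset B J (cs_star B x))"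
      by (intro \<phi>_unary in_carrier X star)
    show "(INF x\<in>\<phi> X. cs_norm B x) = (INF x\<in>X. cs_norm A x)"
      by (intro norm in_carrier X)
  qed (rule bij)
  then show ?thesis
    unfolding cstar_isomorphic_def by blast
qed

section \<open>Adjoints of operators on a complex Hilbert space\<close>

lemma cinner_add_right: "cinner z (x + y :: 'h::complex_hilbert_space) = cinner z x + cinner z y"
  by (metis cinner_add_left cinner_commute complex_cnj_add)

lemma cinner_scaleC_right: "cinner x (c *\<^sub>C (y :: 'h::complex_hilbert_space)) = cnj c * cinner x y"
  by (metis cinner_commute cinner_scaleC_left complex_cnj_mult)

lemma cinner_diff_left: "cinner (x - y :: 'h::complex_hilbert_space) z = cinner x z - cinner y z"
  by (metis add_diff_cancel_right' cinner_add_left diff_add_cancel)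

lemma cinner_diff_right: "cinner z (x - y :: 'h::complex_hilbert_space) = cinner z x - cinner z y"
  by (metis add_diff_cancel_right' cinner_add_right diff_add_cancel)

lemma Re_cinner_scaleR_left:
  "Re (cinner (r *\<^sub>R x) (y :: 'h::complex_hilbert_space)) = r * Re (cinner x y)"
  by (simp add: scaleR_scaleC cinner_scaleC_left)

lemma Re_cinner_commute: "Re (cinner x (y :: 'h::complex_hilbert_space)) = Re (cinner y x)"
  by (metis cinner_commute complex_cnj(1) complex_surj cnj.sel(1))

lemma Re_cinner_same: "Re (cinner x (x :: 'h::complex_hilbert_space)) = (norm x)\<^sup>2"
  by (simp add: cinner_same)

lemma norm_add_square:
  "(norm (x + y :: 'h::complex_hilbert_space))\<^sup>2 = (norm x)\<^sup>2 + 2 * Re (cinner x y) + (norm y)\<^sup>2"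
  using Re_cinner_commute[of x y]
  by (simp add: Re_cinner_same[symmetric] cinner_add_left cinner_add_right)

lemma norm_diff_square:
  "(norm (x - y :: 'h::complex_hilbert_space))\<^sup>2 = (norm x)\<^sup>2 - 2 * Re (cinner x y) + (norm y)\<^sup>2"
  using Re_cinner_commute[of x y]
  by (simp add: Re_cinner_same[symmetric] cinner_diff_left cinner_diff_right)

text \<open>
  The Cauchy--Schwarz inequality is the triangle inequality for the norm, squared and
  expanded.
\<close>

lemma Re_cinner_le: "Re (cinner x (y :: 'h::complex_hilbert_space)) \<le> norm x * norm y"
proof -
  have "(norm (x + y))\<^sup>2 \<le> (norm x + norm y)\<^sup>2"
    by (simp add: norm_triangle_ineq power_mono)
  then show ?thesis
    by (simp add: norm_add_square power2_sum)
qed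

lemma cinner_right_ext:
  assumes "\<And>z. cinner z x = cinner z (y :: 'h::complex_hilbert_space)"
  shows "x = y"
proof -
  have "cinner (x - y) (x - y) = 0"
    using assms by (simp add: cinner_diff_right)
  then show ?thesis
    by (simp add: cinner_same)
qed

text \<open>
  The vector representing \<open>r\<close> is the minimiser of the energy \<open>J x = (norm x)^2 / 2 - r x\<close>. The energy is
  bounded below because \<open>r\<close> is bounded, the parallelogram law makes every minimising
  sequence Cauchy, and at the minimiser the derivative of \<open>J\<close> in each direction \<open>h\<close>, which is
  \<open>Re (cinner h x) - r h\<close>, vanishes. Real-valued functionals suffice: complex linearity
  recovers imaginary parts from real ones.
\<close>

lemma Riesz_representation_Re:
  fixes r :: "'h::complex_hilbert_space \<Rightarrow> real"
  assumes r: "bounded_linear r"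
  shows "\<exists>x. \<forall>h. r h = Re (cinner h x)"
proof -
  interpret bounded_linear r by (rule r)
  obtain K where K: "\<And>x. norm (r x) \<le> norm x * K"
    using bounded by blast
  define J where "J x = (norm x)\<^sup>2 / 2 - r x" for x
  define m where "m = (INF x. J x)"
  have J_ge: "- (K\<^sup>2 / 2) \<le> J x" for x
  proof -
    have "r x \<le> norm x * K" using K[of x] by simp
    moreover have "0 \<le> (norm x - K)\<^sup>2" by simp
    ultimately show ?thesis by (simp add: J_def power2_diff)
  qed
  then have bdd: "bdd_below (range J)" by (intro bdd_belowI2)
  have m_le: "m \<le> J x" for x
    unfolding m_def by (rule cINF_lower[OF bdd]) simp
  have strict_convex: "(norm (x - y))\<^sup>2 \<le> 4 * (J x + J y - 2 * m)" for x y
  proof -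
    have "(norm ((1/2) *\<^sub>R (x + y)))\<^sup>2 = (norm (x + y))\<^sup>2 / 4"
      unfolding norm_scaleR by (simp add: power_divide)
    moreover have "r ((1/2) *\<^sub>R (x + y)) = (r x + r y) / 2"
      by (simp only: scaleR add) simp
    ultimately have "J x + J y - 2 * J ((1/2) *\<^sub>R (x + y)) = (norm (x - y))\<^sup>2 / 4"
      unfolding J_def by (simp add: norm_add_square norm_diff_square field_simps)
    then show ?thesis using m_le[of "(1/2) *\<^sub>R (x + y)"] by simp
  qed
  have "\<exists>x. J x < m + inverse (Suc n)" for n
    using cINF_less_iff[OF _ bdd, of "m + inverse (Suc n)"] unfolding m_def by auto
  then obtain X where X: "\<And>n. J (X n) < m + inverse (real (Suc n))" by metis
  have "Cauchy X"
  proof (rule metric_CauchyI)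
    fix e :: real assume "0 < e"
    then obtain N where N: "inverse (real (Suc N)) < e\<^sup>2 / 8"
      using reals_Archimedean[of "e\<^sup>2 / 8"] by auto
    have near_inf: "J (X p) - m < e\<^sup>2 / 8" if "p \<ge> N" for p
    proof -
      have "inverse (real (Suc p)) \<le> inverse (real (Suc N))"
        using that by (intro le_imp_inverse_le) auto
      then show ?thesis using X[of p] N by argo
    qed
    have "dist (X p) (X q) < e" if "p \<ge> N" "q \<ge> N" for p q
    proof -
      have "(norm (X p - X q))\<^sup>2 < e\<^sup>2"
        using strict_convex[of "X p" "X q"] near_inf[OF that(1)] near_inf[OF that(2)] by argo
      then show ?thesis
        using \<open>0 < e\<close> by (simp add: dist_norm power_less_imp_less_base)
    qed
    then show "\<exists>M. \<forall>p\<ge>M. \<forall>q\<ge>M. dist (X p) (X q) < e" by blast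
  qed
  then obtain x where x: "X \<longlonglongrightarrow> x"
    using Cauchy_convergent convergent_def by blast
  have "(\<lambda>n. J (X n)) \<longlonglongrightarrow> J x"
    unfolding J_def by (intro tendsto_intros tendsto x) simp
  moreover have "(\<lambda>n. m + inverse (real (Suc n))) \<longlonglongrightarrow> m"
    using tendsto_add[OF tendsto_const[of m] LIMSEQ_inverse_real_of_nat] by simp
  ultimately have "J x \<le> m"
    using X by (intro LIMSEQ_le) (auto intro: less_imp_le)
  have "r h = Re (cinner h x)" for h
  proof -
    define d where "d = Re (cinner h x) - r h"
    \<comment> \<open>\<open>J (x + t h) - J x\<close> as a quadratic in \<open>t\<close>\<close>
    have pos: "0 \<le> t * d + t\<^sup>2 * ((norm h)\<^sup>2 / 2)" for t
    proof -
      have "J x \<le> J (x + t *\<^sub>R h)"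
        using \<open>J x \<le> m\<close> m_le order_trans by blast
      moreover have "J (x + t *\<^sub>R h) = J x + (t * d + t\<^sup>2 * ((norm h)\<^sup>2 / 2))"
        using Re_cinner_commute[of x "t *\<^sub>R h"]
        by (simp add: J_def d_def norm_add_square add scaleR Re_cinner_scaleR_left
            power_mult_distrib algebra_simps)
      ultimately show ?thesis by simp
    qed
    have "d = 0"
    proof (rule ccontr)
      assume "d \<noteq> 0"
      define c where "c = (norm h)\<^sup>2 + 1"
      have "c > 0" by (simp add: c_def add_nonneg_pos)
      \<comment> \<open>The linear term beats the quadratic one at \<open>t = - d / c\<close>; the 1 in \<open>c\<close> covers \<open>h = 0\<close>.\<close>
      have "(-d/c) * d + (-d/c)\<^sup>2 * ((norm h)\<^sup>2 / 2) \<le> (-d/c) * d + (-d/c)\<^sup>2 * (c / 2)"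
        by (intro add_left_mono mult_left_mono) (auto simp: c_def)
      also have "\<dots> = - (d\<^sup>2 / (2 * c))"
        using \<open>c > 0\<close> by (simp add: power2_eq_square field_simps)
      also have "\<dots> < 0"
        using \<open>c > 0\<close> \<open>d \<noteq> 0\<close> by simp
      finally show False using pos[of "-d/c"] by simp
    qed
    then show ?thesis by (simp add: d_def)
  qed
  then show ?thesis by blast
qed

definition complex_linear_op :: "('h::complex_hilbert_space \<Rightarrow>\<^sub>L 'h) \<Rightarrow> bool" where
  "complex_linear_op T \<longleftrightarrow> (\<forall>c x. blinfun_apply T (c *\<^sub>C x) = c *\<^sub>C blinfun_apply T x)"

lemma adjoint_exists:
  fixes T :: "'h::complex_hilbert_space \<Rightarrow>\<^sub>L 'h"
  assumes T: "complex_linear_op T"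
  shows "\<exists>S. \<forall>x y. cinner (blinfun_apply T x) y = cinner x (blinfun_apply S y)"
proof -
  have "\<exists>z. \<forall>x. cinner (T x) y = cinner x z" for y
  proof -
    have "bounded_linear (\<lambda>x. Re (cinner (T x) y))"
    proof (rule bounded_linear_intro)
      fix x
      have "Re (cinner (T x) y) \<le> norm (T x) * norm y" "- Re (cinner (T x) y) \<le> norm (T x) * norm y"
        using Re_cinner_le[of "T x" y] Re_cinner_le[of "- T x" y] cinner_diff_left[of 0 "T x" y]
          cinner_diff_left[of 0 0 y] by auto
      moreover have "norm (T x) * norm y \<le> norm x * (norm T * norm y)"
        using mult_right_mono[OF norm_blinfun[of T x], of "norm y"] by (simp add: mult_ac)
      ultimately show "norm (Re (cinner (T x) y)) \<le> norm x * (norm T * norm y)"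
        by simp
    qed (simp_all add: blinfun.add_right blinfun.scaleR_right cinner_add_left Re_cinner_scaleR_left)
    then obtain z where z: "\<And>x. Re (cinner (T x) y) = Re (cinner x z)"
      using Riesz_representation_Re by blast
    \<comment> \<open>The real part at \<open>\<i> x\<close> is minus the imaginary part at \<open>x\<close>.\<close>
    have "Im (cinner (T x) y) = Im (cinner x z)" for x
      using z[of "\<i> *\<^sub>C x"] T by (simp add: complex_linear_op_def cinner_scaleC_left)
    then show ?thesis
      using z complex_eqI by blast
  qed
  then obtain S where S: "\<And>x y. cinner (T x) y = cinner x (S y)" by metis
  have "bounded_linear S"
  proof (rule bounded_linear_intro)
    show "S (x + y) = S x + S y" for x y
      by (rule cinner_right_ext) (simp add: S[symmetric] cinner_add_right)
    show "S (t *\<^sub>R x) = t *\<^sub>R S x" for t x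
      by (rule cinner_right_ext) (simp add: S[symmetric] scaleR_scaleC cinner_scaleC_right)
    fix x
    have "norm (S x) * norm (S x) = Re (cinner (T (S x)) x)"
      by (simp add: S Re_cinner_same power2_eq_square[symmetric])
    also have "\<dots> \<le> norm (T (S x)) * norm x" by (rule Re_cinner_le)
    also have "\<dots> \<le> norm T * norm (S x) * norm x"
      by (intro mult_right_mono norm_blinfun) simp
    finally have "norm (S x) * norm (S x) \<le> norm (S x) * (norm x * norm T)"
      by (simp add: mult_ac)
    then show "norm (S x) \<le> norm x * norm T"
      by (cases "norm (S x) = 0") (auto simp: mult_le_cancel_left)
  qed
  then show ?thesis
    using S by (metis bounded_linear_Blinfun_apply)
qed

text \<open>
  The defining relation has at most one solution, which is why the definite description in \<^const>\<open>op_adjoint\<close> denotes.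
\<close>

lemma adjoint_eqI:
  assumes "\<And>x y. cinner (blinfun_apply T x) y = cinner x (blinfun_apply S y)"
  shows "op_adjoint T = S"
  unfolding op_adjoint_def
proof (rule the_equality)
  fix S' assume S': "\<forall>x y. cinner (blinfun_apply T x) y = cinner x (blinfun_apply S' y)"
  show "S' = S"
    by (intro blinfun_eqI cinner_right_ext) (metis S' assms)
qed (use assms in blast)

lemma cinner_adjoint:
  assumes "complex_linear_op T"
  shows "cinner (blinfun_apply T x) y = cinner x (blinfun_apply (op_adjoint T) y)"
  using adjoint_exists[OF assms] adjoint_eqI by metis

text \<open>
  Keeping \<open>T\<close> applied to \<open>T* x\<close> on the right, instead of estimating it by the operator norm,
  lets compactness pass from \<open>T\<close> to its adjoint.
\<close>

lemma norm_adjoint_apply_square: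
  assumes "complex_linear_op T"
  shows "(norm (blinfun_apply (op_adjoint T) x))\<^sup>2 \<le> norm (blinfun_apply T (blinfun_apply (op_adjoint T) x)) * norm x"
  using Re_cinner_le[of "T (op_adjoint T x)" x]
  by (simp add: cinner_adjoint[OF assms] Re_cinner_same)

lemma norm_adjoint_le:
  assumes "complex_linear_op T"
  shows "norm (op_adjoint T) \<le> norm T"
proof (rule norm_blinfun_bound)
  fix x
  let ?S = "op_adjoint T"
  have "norm (?S x) * norm (?S x) \<le> norm (T (?S x)) * norm x"
    using norm_adjoint_apply_square[OF assms, of x] by (simp add: power2_eq_square)
  also have "\<dots> \<le> norm T * norm (?S x) * norm x"
    by (intro mult_right_mono norm_blinfun) simp
  finally have "norm (?S x) * norm (?S x) \<le> norm (?S x) * (norm T * norm x)"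
    by (simp add: mult_ac)
  then show "norm (?S x) \<le> norm T * norm x"
    by (cases "norm (?S x) = 0") (auto simp: mult_le_cancel_left)
qed simp

lemma complex_linear_diff:
  assumes "complex_linear_op S" "complex_linear_op T"
  shows "complex_linear_op (S - T)"
proof -
  have "c *\<^sub>C (x - y) = c *\<^sub>C x - c *\<^sub>C y" for c and x y :: 'a
    by (metis add_diff_cancel_right' diff_add_cancel scaleC_add_right)
  with assms show ?thesis
    by (simp add: complex_linear_op_def blinfun.diff_left)
qed

lemma adjoint_diff:
  assumes "complex_linear_op S" "complex_linear_op T"
  shows "op_adjoint (S - T) = op_adjoint S - op_adjoint T"
  by (rule adjoint_eqI)
    (simp add: blinfun.diff_left cinner_diff_left cinner_diff_right cinner_adjoint assms)

lemma norm_adjoint_diff_le: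
  assumes "complex_linear_op S" "complex_linear_op T"
  shows "norm (op_adjoint S - op_adjoint T) \<le> norm (S - T)"
  using norm_adjoint_le[OF complex_linear_diff[OF assms]] by (simp add: adjoint_diff[OF assms])

lemma complex_linear_adjoint:
  assumes "complex_linear_op T"
  shows "complex_linear_op (op_adjoint T)"
  unfolding complex_linear_op_def
  by (intro allI cinner_right_ext) (simp add: cinner_adjoint[OF assms, symmetric] cinner_scaleC_right)

section \<open>The algebra of compact operators\<close>

lemma compact_ops_iff:
  "T \<in> compact_ops \<longleftrightarrow>
    complex_linear_op T \<and> (\<exists>K. compact K \<and> blinfun_apply T ` cball 0 1 \<subseteq> K)"
proof -
  have "compact (closure S) \<longleftrightarrow> (\<exists>K. compact K \<and> S \<subseteq> K)" for S :: "'a set"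
  proof
    assume "\<exists>K. compact K \<and> S \<subseteq> K"
    then obtain K where K: "compact K" "S \<subseteq> K" by blast
    then have "closure S \<subseteq> K"
      by (simp add: closure_minimal compact_imp_closed)
    then have "closure S = K \<inter> closure S" by blast
    then show "compact (closure S)"
      using K(1) by (metis closed_closure compact_Int_closed)
  qed (use closure_subset in blast)
  then show ?thesis
    by (simp add: compact_ops_def complex_linear_op_def)
qed

lemma compact_closure_sequentially:
  fixes S :: "'a::metric_space set"
  assumes S: "\<And>y. (\<And>n::nat. y n \<in> S) \<Longrightarrow> \<exists>l r. strict_mono r \<and> (y \<circ> r) \<longlonglongrightarrow> l"
  shows "compact (closure S)"
proof (subst compact_eq_seq_compact_metric, rule seq_compactI)
  fix z :: "nat \<Rightarrow> 'a" assume "\<forall>n. z n \<in> closure S"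
  then have "\<exists>y\<in>S. dist y (z n) < inverse (Suc n)" for n
    by (simp add: closure_approachable)
  then obtain y where y: "\<And>n. y n \<in> S" "\<And>n. dist (y n) (z n) < inverse (real (Suc n))"
    by metis
  obtain l r where r: "strict_mono r" "(y \<circ> r) \<longlonglongrightarrow> l"
    using S y(1) by blast
  have "(\<lambda>n. dist (y n) (z n)) \<longlonglongrightarrow> 0"
  proof (rule tendsto_sandwich[OF _ _ tendsto_const LIMSEQ_inverse_real_of_nat])
    show "\<forall>\<^sub>F n in sequentially. dist (y n) (z n) \<le> inverse (real (Suc n))"
      by (intro always_eventually allI less_imp_le y(2))
  qed simp
  then have "((\<lambda>n. dist (y n) (z n)) \<circ> r) \<longlonglongrightarrow> 0"
    by (rule LIMSEQ_subseq_LIMSEQ[OF _ r(1)])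
  then have "(\<lambda>n. dist (y (r n)) (z (r n)) + dist (y (r n)) l) \<longlonglongrightarrow> 0 + 0"
    using r(2)[THEN tendsto_dist_iff[THEN iffD1]] unfolding comp_def by (rule tendsto_add)
  then have "(z \<circ> r) \<longlonglongrightarrow> l"
  proof (rule metric_tendsto_imp_tendsto)
    have "dist ((z \<circ> r) n) l \<le> dist (dist (y (r n)) (z (r n)) + dist (y (r n)) l) (0 + 0)" for n
      using dist_triangle3[of "z (r n)" l "y (r n)"] by (simp add: dist_real_def)
    then show "\<forall>\<^sub>F n in sequentially. dist ((z \<circ> r) n) l
        \<le> dist (dist (y (r n)) (z (r n)) + dist (y (r n)) l) (0 + 0)"
      by (intro always_eventually allI)
  qed
  moreover have "l \<in> closure S"
    unfolding closure_sequential using r(2) y(1) by (intro exI[of _ "y \<circ> r"]) simp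
  ultimately show "\<exists>l\<in>closure S. \<exists>r. strict_mono r \<and> (z \<circ> r) \<longlonglongrightarrow> l"
    using r(1) by blast
qed

lemma compact_ops_linear: "T \<in> compact_ops \<Longrightarrow> complex_linear_op T"
  by (simp add: compact_ops_iff)

lemma compact_ops_add:
  assumes "S \<in> compact_ops" "T \<in> compact_ops"
  shows "S + T \<in> compact_ops"
proof -
  obtain K L where K: "compact K" "S ` cball 0 1 \<subseteq> K" and L: "compact L" "T ` cball 0 1 \<subseteq> L"
    using assms unfolding compact_ops_iff by blast
  have "(S + T) ` cball 0 1 \<subseteq> {x + y |x y. x \<in> K \<and> y \<in> L}"
    using K(2) L(2) by (fastforce simp: blinfun.add_left)
  moreover have "complex_linear_op (S + T)"
    using assms by (simp add: compact_ops_iff complex_linear_op_def blinfun.add_left scaleC_add_right)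
  ultimately show ?thesis
    using compact_sums[OF K(1) L(1)] unfolding compact_ops_iff by blast
qed

lemma compact_ops_scale:
  assumes "T \<in> compact_ops"
  shows "op_scale c T \<in> compact_ops"
proof -
  obtain K where K: "compact K" "T ` cball 0 1 \<subseteq> K"
    using assms unfolding compact_ops_iff by blast
  \<comment> \<open>Scaling a vector by \<open>c\<close> is continuous, being the bounded operator \<open>op_scale c id_blinfun\<close>.\<close>
  have "continuous_on K (blinfun_apply (op_scale c id_blinfun))"
    by (intro continuous_intros)
  then have "compact (op_scale c id_blinfun ` K)"
    using K(1) compact_continuous_image by blast
  moreover have "op_scale c T ` cball 0 1 \<subseteq> op_scale c id_blinfun ` K"
    using K(2) by (auto simp: op_scale_apply)
  moreover have "complex_linear_op (op_scale c T)"
    using assms by (simp add: compact_ops_iff complex_linear_op_def op_scale_apply scaleC_scaleC mult.commute)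
  ultimately show ?thesis
    unfolding compact_ops_iff by blast
qed

lemma op_scale_of_real: "op_scale (of_real r) T = r *\<^sub>R T"
  by (rule blinfun_eqI) (simp add: op_scale_apply blinfun.scaleR_left scaleR_scaleC)

lemma compact_ops_scaleR: "T \<in> compact_ops \<Longrightarrow> r *\<^sub>R T \<in> compact_ops"
  using compact_ops_scale[of T "of_real r"] by (simp add: op_scale_of_real)

lemma compact_ops_diff: "S \<in> compact_ops \<Longrightarrow> T \<in> compact_ops \<Longrightarrow> S - T \<in> compact_ops"
  using compact_ops_add[of S "(-1) *\<^sub>R T"] compact_ops_scaleR[of T "-1"] by simp

lemma compact_ops_compose_right:
  assumes "T \<in> compact_ops" "complex_linear_op S"
  shows "T o\<^sub>L S \<in> compact_ops"
proof -
  obtain K where K: "compact K" "T ` cball 0 1 \<subseteq> K"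
    using assms unfolding compact_ops_iff by blast
  \<comment> \<open>\<open>S\<close> maps the unit ball into the ball of radius \<open>c\<close>; the 1 makes \<open>c\<close> invertible if \<open>S = 0\<close>.\<close>
  define c where "c = norm S + 1"
  have "c > 0" by (simp add: c_def add_nonneg_pos)
  have "(T o\<^sub>L S) ` cball 0 1 \<subseteq> (\<lambda>y. c *\<^sub>R y) ` K"
  proof
    fix z assume "z \<in> (T o\<^sub>L S) ` cball 0 1"
    then obtain x where x: "norm x \<le> 1" "z = T (S x)" by auto
    have "norm (S x) \<le> norm S * norm x" by (rule norm_blinfun)
    also have "\<dots> \<le> norm S" using x(1) by (simp add: mult_left_le)
    finally have "norm (inverse c *\<^sub>R S x) \<le> 1"
      using \<open>c > 0\<close> by (simp add: c_def field_simps)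
    then have "T (inverse c *\<^sub>R S x) \<in> K" using K(2) by auto
    moreover have "z = c *\<^sub>R T (inverse c *\<^sub>R S x)"
      using \<open>c > 0\<close> x(2) by (simp add: blinfun.scaleR_right)
    ultimately show "z \<in> (\<lambda>y. c *\<^sub>R y) ` K" by blast
  qed
  moreover have "compact ((\<lambda>y. c *\<^sub>R y) ` K)"
    using K(1) by (rule compact_scaling)
  moreover have "complex_linear_op (T o\<^sub>L S)"
    using assms by (simp add: compact_ops_iff complex_linear_op_def)
  ultimately show ?thesis
    unfolding compact_ops_iff by blast
qed

text \<open>
  For \<open>y n\<close> in the unit ball, compactness of \<open>T T*\<close> gives a subsequence along which
  \<open>T T* (y n)\<close> converges. The estimate \<open>(norm (T* d))^2 \<le> norm (T T* d) * norm d\<close>, applied to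
  differences \<open>d\<close> of members, then shows that \<open>T* (y n)\<close> is Cauchy along it.
\<close>

lemma compact_ops_adjoint:
  assumes "T \<in> compact_ops"
  shows "op_adjoint T \<in> compact_ops"
proof -
  let ?S = "op_adjoint T"
  have lin: "complex_linear_op T" "complex_linear_op ?S"
    using assms by (auto simp: compact_ops_iff complex_linear_adjoint)
  obtain K where K: "compact K" "(T o\<^sub>L ?S) ` cball 0 1 \<subseteq> K"
    using compact_ops_compose_right[OF assms lin(2)] unfolding compact_ops_iff by blast
  have subseq: "\<exists>l r. strict_mono r \<and> ((\<lambda>n. ?S (y n)) \<circ> r) \<longlonglongrightarrow> l"
    if y: "\<And>n. norm (y n) \<le> 1" for y :: "nat \<Rightarrow> 'a"
  proof -
    have "\<forall>n. T (?S (y n)) \<in> K"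
      using K(2) y by (auto simp: image_subset_iff)
    then obtain l r where r: "strict_mono r" "((\<lambda>n. T (?S (y n))) \<circ> r) \<longlonglongrightarrow> l"
      by (rule seq_compactE[OF compact_imp_seq_compact[OF K(1)]])
    have "Cauchy ((\<lambda>n. ?S (y n)) \<circ> r)"
    proof (rule metric_CauchyI)
      fix e :: real assume "0 < e"
      then have "0 < e\<^sup>2 / 2" by simp
      then obtain M where M: "\<And>p q. p \<ge> M \<Longrightarrow> q \<ge> M \<Longrightarrow>
          dist (T (?S (y (r p)))) (T (?S (y (r q)))) < e\<^sup>2 / 2"
        using metric_CauchyD[OF LIMSEQ_imp_Cauchy[OF r(2)]] unfolding comp_def by blast
      have "dist (?S (y (r p))) (?S (y (r q))) < e" if "p \<ge> M" "q \<ge> M" for p q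
      proof -
        let ?d = "y (r p) - y (r q)"
        have "norm ?d \<le> 2"
          using norm_triangle_ineq4[of "y (r p)" "y (r q)"] y[of "r p"] y[of "r q"] by linarith
        have "(norm (?S ?d))\<^sup>2 \<le> norm (T (?S ?d)) * norm ?d"
          by (rule norm_adjoint_apply_square[OF lin(1)])
        also have "\<dots> \<le> norm (T (?S ?d)) * 2"
          using \<open>norm ?d \<le> 2\<close> by (intro mult_left_mono) auto
        also have "\<dots> < e\<^sup>2"
          using M[OF that] by (simp add: dist_norm blinfun.diff_right)
        finally show ?thesis
          using \<open>0 < e\<close> by (simp add: dist_norm blinfun.diff_right power_less_imp_less_base)
      qed
      then show "\<exists>M. \<forall>p\<ge>M. \<forall>q\<ge>M. dist (((\<lambda>n. ?S (y n)) \<circ> r) p) (((\<lambda>n. ?S (y n)) \<circ> r) q) < e"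
        by (auto simp: comp_def)
    qed
    then show ?thesis
      using r(1) Cauchy_convergent convergent_def by blast
  qed
  have "compact (closure (?S ` cball 0 1))"
  proof (rule compact_closure_sequentially)
    fix z :: "nat \<Rightarrow> 'a" assume zS: "\<And>n. z n \<in> ?S ` cball 0 1"
    have "\<forall>n. \<exists>y. norm y \<le> 1 \<and> z n = ?S y"
      using zS by (simp add: image_iff Bex_def)
    then obtain y where y: "\<And>n. norm (y n) \<le> 1" and z: "z = (\<lambda>n. ?S (y n))"
      unfolding choice_iff by blast
    show "\<exists>l r. strict_mono r \<and> (z \<circ> r) \<longlonglongrightarrow> l"
      unfolding z by (rule subseq) (rule y)
  qed
  then show ?thesis
    using lin(2) by (simp add: compact_ops_def complex_linear_op_def)
qed

section \<open>Slowly oscillating functions\<close>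

text \<open>
  The window length \<open>d\<close> is a parameter because the variation condition comes with length
  \<open>b - a\<close>, while sampling at the integers wants length 1. \<open>T\<close> is kept nonnegative so that
  \<open>f\<close> is only evaluated on the half-line.
\<close>

definition slowly_oscillating :: "real \<Rightarrow> (real \<Rightarrow> 'a::real_normed_vector) \<Rightarrow> bool" where
  "slowly_oscillating d f \<longleftrightarrow>
    (\<forall>\<epsilon>>0. \<exists>T\<ge>0. \<forall>u\<ge>T. \<forall>s\<in>{0..d}. norm (f (u + s) - f u) \<le> \<epsilon>)"

text \<open>
  Cut a step of length at most \<open>D\<close> into \<open>N\<close> steps of length at most \<open>d\<close>. The number
  \<open>N\<close> depends only on \<open>D\<close> and \<open>d\<close>, so it can be absorbed into the tolerance.
\<close>

lemma slowly_oscillating_change_step: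
  assumes f: "slowly_oscillating d f" and "0 < d"
  shows "slowly_oscillating D f"
  unfolding slowly_oscillating_def
proof (intro allI impI)
  fix \<epsilon> :: real assume "0 < \<epsilon>"
  obtain N where N: "D < real N * d"
    using reals_Archimedean3[OF \<open>0 < d\<close>] by blast
  define \<delta> where "\<delta> = \<epsilon> / (real N + 1)"
  have "0 < \<delta>" using \<open>0 < \<epsilon>\<close> by (simp add: \<delta>_def add_nonneg_pos)
  then obtain T where "T \<ge> 0"
    and T: "\<And>u s. u \<ge> T \<Longrightarrow> 0 \<le> s \<Longrightarrow> s \<le> d \<Longrightarrow> norm (f (u + s) - f u) \<le> \<delta>"
    using f unfolding slowly_oscillating_def by (meson atLeastAtMost_iff)
  have steps: "norm (f (u + s) - f u) \<le> real n * \<delta>"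
    if "u \<ge> T" "0 \<le> s" "s \<le> real n * d" for u s n
    using that
  proof (induction n arbitrary: u s)
    case 0
    then show ?case by simp
  next
    case (Suc n)
    show ?case
    proof (cases "s \<le> d")
      case True
      then have "norm (f (u + s) - f u) \<le> \<delta>" using T Suc.prems by blast
      also have "\<dots> \<le> real (Suc n) * \<delta>" using \<open>0 < \<delta>\<close> by simp
      finally show ?thesis .
    next
      case False
      have "norm (f (u + d + (s - d)) - f (u + d)) \<le> real n * \<delta>"
        using False Suc.prems \<open>0 < d\<close> by (intro Suc.IH) (auto simp: algebra_simps)
      moreover have "norm (f (u + d) - f u) \<le> \<delta>"
        using Suc.prems \<open>0 < d\<close> by (intro T) auto
      ultimately have "norm (f (u + d + (s - d)) - f u) \<le> real n * \<delta> + \<delta>"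
        by (rule norm_diff_triangle_le)
      then show ?thesis by (simp add: algebra_simps)
    qed
  qed
  have "real N * \<delta> \<le> \<epsilon>"
    using \<open>0 < \<epsilon>\<close> by (simp add: \<delta>_def field_simps)
  then have "norm (f (u + s) - f u) \<le> \<epsilon>" if "u \<ge> T" "s \<in> {0..D}" for u s
    using steps[of u s N] that N by force
  then show "\<exists>T\<ge>0. \<forall>u\<ge>T. \<forall>s\<in>{0..D}. norm (f (u + s) - f u) \<le> \<epsilon>"
    using \<open>T \<ge> 0\<close> by blast
qed

lemma slowly_oscillating_cong:
  assumes f: "slowly_oscillating d f" and eq: "\<And>t. t \<ge> 0 \<Longrightarrow> f t = g t"
  shows "slowly_oscillating d g"
  unfolding slowly_oscillating_def
proof (intro allI impI)
  fix \<epsilon> :: real assume "0 < \<epsilon>"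
  then obtain T where "T \<ge> 0" and T: "\<forall>u\<ge>T. \<forall>s\<in>{0..d}. norm (f (u + s) - f u) \<le> \<epsilon>"
    using f unfolding slowly_oscillating_def by meson
  then show "\<exists>T\<ge>0. \<forall>u\<ge>T. \<forall>s\<in>{0..d}. norm (g (u + s) - g u) \<le> \<epsilon>"
    by (intro exI[of _ T]) (simp add: eq[symmetric])
qed

lemma Var_tendsto_zero_iff:
  fixes f :: "real \<Rightarrow> ('h::complex_hilbert_space \<Rightarrow>\<^sub>L 'h)"
  assumes f: "bounded (f ` {0..})" and "0 \<le> a" "a < b"
  shows "((\<lambda>t. Var (a + t) (b + t) f) \<longlongrightarrow> 0) at_top \<longleftrightarrow> slowly_oscillating (b - a) f"
proof -
  obtain M where M: "\<And>t. t \<ge> 0 \<Longrightarrow> norm (f t) \<le> M"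
    using f unfolding bounded_iff by auto
  have Var_ge: "norm (f t2 - f t1) \<le> Var (a + t) (b + t) f"
    if "t \<ge> 0" "t1 \<in> {a + t..b + t}" "t2 \<in> {a + t..b + t}" for t t1 t2
  proof -
    have "bdd_above ((\<lambda>(t1, t2). norm (f t2 - f t1)) ` ({a + t..b + t} \<times> {a + t..b + t}))"
    proof (rule bdd_aboveI2[of _ _ "M + M"], clarify)
      fix p q assume "p \<in> {a + t..b + t}" "q \<in> {a + t..b + t}"
      then show "norm (f q - f p) \<le> M + M"
        using M[of p] M[of q] norm_triangle_ineq4[of "f q" "f p"] \<open>t \<ge> 0\<close> \<open>0 \<le> a\<close> by simp
    qed
    then show ?thesis
      unfolding Var_def by (rule cSUP_upper2[where x = "(t1, t2)"]) (use that in auto)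
  qed
  show ?thesis
  proof
    assume lim: "((\<lambda>t. Var (a + t) (b + t) f) \<longlongrightarrow> 0) at_top"
    show "slowly_oscillating (b - a) f"
      unfolding slowly_oscillating_def
    proof (intro allI impI)
      fix \<epsilon> :: real assume "0 < \<epsilon>"
      then obtain T where T: "\<And>t. t \<ge> T \<Longrightarrow> Var (a + t) (b + t) f < \<epsilon>"
        using order_tendstoD(2)[OF lim] unfolding eventually_at_top_linorder by blast
      have "norm (f (u + s) - f u) \<le> \<epsilon>" if "u \<ge> a + max 0 T" "s \<in> {0..b - a}" for u s
      proof -
        have "u - a \<ge> T" "u - a \<ge> 0" using that by auto
        then show ?thesis
          using Var_ge[of "u - a" u "u + s"] T[of "u - a"] that \<open>a < b\<close> by auto
      qed
      then show "\<exists>T\<ge>0. \<forall>u\<ge>T. \<forall>s\<in>{0..b - a}. norm (f (u + s) - f u) \<le> \<epsilon>"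
        using \<open>0 \<le> a\<close> by (intro exI[of _ "a + max 0 T"]) auto
    qed
  next
    assume slow: "slowly_oscillating (b - a) f"
    show "((\<lambda>t. Var (a + t) (b + t) f) \<longlongrightarrow> 0) at_top"
    proof (rule tendstoI)
      fix \<epsilon> :: real assume "0 < \<epsilon>"
      then obtain T where "T \<ge> 0"
        and T: "\<And>u s. u \<ge> T \<Longrightarrow> s \<in> {0..b - a} \<Longrightarrow> norm (f (u + s) - f u) \<le> \<epsilon> / 2"
        using slow unfolding slowly_oscillating_def by (meson half_gt_zero)
      have "dist (Var (a + t) (b + t) f) 0 < \<epsilon>" if "t \<ge> T" for t
      proof -
        have "norm (f q - f p) \<le> \<epsilon> / 2" if "p \<in> {a + t..b + t}" "q \<in> {a + t..b + t}" for p q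
        proof (cases "p \<le> q")
          case True
          then show ?thesis
            using T[of p "q - p"] that \<open>t \<ge> T\<close> \<open>0 \<le> a\<close> by auto
        next
          case False
          then show ?thesis
            using T[of q "p - q"] that \<open>t \<ge> T\<close> \<open>0 \<le> a\<close> by (auto simp: norm_minus_commute)
        qed
        then have "Var (a + t) (b + t) f \<le> \<epsilon> / 2"
          unfolding Var_def using \<open>a < b\<close> by (intro cSUP_least) auto
        moreover have "0 \<le> Var (a + t) (b + t) f"
          using Var_ge[of t "a + t" "a + t"] \<open>a < b\<close> \<open>T \<ge> 0\<close> \<open>t \<ge> T\<close> by simp
        ultimately show ?thesis
          using \<open>0 < \<epsilon>\<close> by simp
      qed
      then show "\<forall>\<^sub>F t in at_top. dist (Var (a + t) (b + t) f) 0 < \<epsilon>"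
        unfolding eventually_at_top_linorder by blast
    qed
  qed
qed

lemma C_b_vv_iff:
  assumes "0 \<le> a" "a < b"
  shows "f \<in> C_b_vv a b \<longleftrightarrow> f \<in> C_b \<and> slowly_oscillating 1 f"
proof -
  have "slowly_oscillating (b - a) f \<longleftrightarrow> slowly_oscillating 1 f"
    using slowly_oscillating_change_step[of "b - a" f 1]
      slowly_oscillating_change_step[of 1 f "b - a"] assms by auto
  then show ?thesis
    using Var_tendsto_zero_iff[of f a b] assms by (auto simp: C_b_vv_def C_b_def)
qed

lemma C_0_subset_C_b_vv:
  assumes "0 \<le> a" "a < b"
  shows "C_0 \<subseteq> C_b_vv a b"
proof
  fix f :: "real \<Rightarrow> ('h::complex_hilbert_space \<Rightarrow>\<^sub>L 'h)"
  assume f: "f \<in> C_0"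
  then have lim: "((\<lambda>t. norm (f t)) \<longlongrightarrow> 0) at_top" and cont: "continuous_on {0..} f"
    and fE: "f \<in> {0..} \<rightarrow>\<^sub>E compact_ops"
    by (auto simp: C_0_def)
  have small: "\<exists>T\<ge>0. \<forall>t\<ge>T. norm (f t) \<le> \<epsilon>" if pos: "\<epsilon> > 0" for \<epsilon>
  proof -
    obtain T where "\<And>t. t \<ge> T \<Longrightarrow> norm (f t) < \<epsilon>"
      using order_tendstoD(2)[OF lim pos] unfolding eventually_at_top_linorder by blast
    then show ?thesis
      by (intro exI[of _ "max 0 T"]) (auto intro: less_imp_le)
  qed
  have "bounded (f ` {0..})"
  proof -
    obtain T where "T \<ge> 0" and T: "\<And>t. t \<ge> T \<Longrightarrow> norm (f t) \<le> 1"
      using small[of 1] by auto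
    have "compact (f ` {0..T})"
      using cont by (intro compact_continuous_image) (auto elim: continuous_on_subset)
    then have "bounded (f ` {0..T} \<union> cball 0 1)"
      using compact_imp_bounded by simp
    moreover have "f ` {0..} \<subseteq> f ` {0..T} \<union> cball 0 1"
    proof
      fix x assume "x \<in> f ` {0..}"
      then obtain t where "t \<ge> 0" "x = f t" by auto
      then show "x \<in> f ` {0..T} \<union> cball 0 1"
        using T[of t] by (cases "t \<le> T") auto
    qed
    ultimately show ?thesis
      by (rule bounded_subset)
  qed
  moreover have "slowly_oscillating 1 f"
    unfolding slowly_oscillating_def
  proof (intro allI impI)
    fix \<epsilon> :: real assume "0 < \<epsilon>"
    then obtain T where "T \<ge> 0" and T: "\<And>t. t \<ge> T \<Longrightarrow> norm (f t) \<le> \<epsilon> / 2"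
      using small[of "\<epsilon> / 2"] by auto
    have "norm (f (u + s) - f u) \<le> \<epsilon>" if "u \<ge> T" "s \<in> {0..1}" for u s
      using T[of "u + s"] T[of u] norm_triangle_ineq4[of "f (u + s)" "f u"] that by auto
    then show "\<exists>T\<ge>0. \<forall>u\<ge>T. \<forall>s\<in>{0..1}. norm (f (u + s) - f u) \<le> \<epsilon>"
      using \<open>T \<ge> 0\<close> by blast
  qed
  ultimately show "f \<in> C_b_vv a b"
    using fE cont by (simp add: C_b_vv_iff[OF assms] C_b_def)
qed

text \<open>
  Boundedness, continuity and slow oscillation of a combination \<open>p (f s) (g s)\<close> all follow
  from one estimate of its increments by those of \<open>f\<close> and \<open>g\<close>. A Lipschitz constant on each
  ball is what multiplication admits; unary operations are the case of a \<open>p\<close> that ignores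
  one argument.
\<close>

lemma C_b_vv_pointwise:
  fixes p :: "('h::complex_hilbert_space \<Rightarrow>\<^sub>L 'h) \<Rightarrow> ('h \<Rightarrow>\<^sub>L 'h) \<Rightarrow> ('h \<Rightarrow>\<^sub>L 'h)"
  assumes ab: "0 \<le> a" "a < b" and f: "f \<in> C_b_vv a b" and g: "g \<in> C_b_vv a b"
    and closed: "\<And>S T. S \<in> compact_ops \<Longrightarrow> T \<in> compact_ops \<Longrightarrow> p S T \<in> compact_ops"
    and lipschitz: "\<And>M. \<exists>L\<ge>0. \<forall>S\<in>compact_ops \<inter> cball 0 M. \<forall>S'\<in>compact_ops \<inter> cball 0 M.
      \<forall>T\<in>compact_ops \<inter> cball 0 M. \<forall>T'\<in>compact_ops \<inter> cball 0 M.
      norm (p S T - p S' T') \<le> L * (norm (S - S') + norm (T - T'))"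
  shows "(\<lambda>s\<in>{0..}. p (f s) (g s)) \<in> C_b_vv a b"
proof -
  have fE: "f \<in> {0..} \<rightarrow>\<^sub>E compact_ops" "continuous_on {0..} f" "bounded (f ` {0..})"
      "slowly_oscillating 1 f"
    and gE: "g \<in> {0..} \<rightarrow>\<^sub>E compact_ops" "continuous_on {0..} g" "bounded (g ` {0..})"
      "slowly_oscillating 1 g"
    using f g by (auto simp: C_b_vv_iff[OF ab] C_b_def)
  define h where "h = (\<lambda>s\<in>{0..}. p (f s) (g s))"
  have "bounded (f ` {0..} \<union> g ` {0..})"
    using fE(3) gE(3) by simp
  then obtain M where "\<And>t. t \<ge> 0 \<Longrightarrow> norm (f t) \<le> M" "\<And>t. t \<ge> 0 \<Longrightarrow> norm (g t) \<le> M"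
    unfolding bounded_iff by auto
  then have ball: "f t \<in> compact_ops \<inter> cball 0 M" "g t \<in> compact_ops \<inter> cball 0 M" if "t \<ge> 0" for t
    using fE(1) gE(1) that by (auto simp: PiE_iff)
  obtain L where "L \<ge> 0"
    and "\<forall>S\<in>compact_ops \<inter> cball 0 M. \<forall>S'\<in>compact_ops \<inter> cball 0 M.
      \<forall>T\<in>compact_ops \<inter> cball 0 M. \<forall>T'\<in>compact_ops \<inter> cball 0 M.
      norm (p S T - p S' T') \<le> L * (norm (S - S') + norm (T - T'))"
    using lipschitz[of M] by blast
  then have L: "norm (h t - h s) \<le> L * (norm (f t - f s) + norm (g t - g s))"
    if "t \<ge> 0" "s \<ge> 0" for s t
    using ball that by (simp add: h_def)
  have "h \<in> {0..} \<rightarrow>\<^sub>E compact_ops"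
    using closed fE(1) gE(1) by (auto simp: h_def PiE_iff)
  moreover have "continuous_on {0..} h"
    unfolding continuous_on_def
  proof
    fix t :: real assume t: "t \<in> {0..}"
    have "((\<lambda>s. L * (norm (f s - f t) + norm (g s - g t))) \<longlongrightarrow>
        L * (norm (f t - f t) + norm (g t - g t))) (at t within {0..})"
      using fE(2) gE(2) t unfolding continuous_on_def by (intro tendsto_intros) auto
    then have "((\<lambda>s. L * (norm (f s - f t) + norm (g s - g t))) \<longlongrightarrow> 0) (at t within {0..})"
      by simp
    then show "(h \<longlongrightarrow> h t) (at t within {0..})"
    proof (rule metric_tendsto_imp_tendsto)
      have "dist (h s) (h t) \<le> dist (L * (norm (f s - f t) + norm (g s - g t))) 0" if "s \<in> {0..}" for s
        using L[of s t] t that \<open>L \<ge> 0\<close> by (simp add: dist_norm)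
      then show "\<forall>\<^sub>F s in at t within {0..}. dist (h s) (h t)
          \<le> dist (L * (norm (f s - f t) + norm (g s - g t))) 0"
        unfolding eventually_at_filter by (intro always_eventually) blast
    qed
  qed
  moreover have "bounded (h ` {0..})"
    unfolding bounded_iff
  proof (intro exI ballI)
    fix x assume "x \<in> h ` {0..}"
    then obtain t where t: "t \<ge> 0" "x = h t" by auto
    have "norm (f t - f 0) + norm (g t - g 0) \<le> (M + M) + (M + M)"
      using ball[of t] ball[of 0] norm_triangle_ineq4[of "f t" "f 0"]
        norm_triangle_ineq4[of "g t" "g 0"] t by auto
    then have "norm (h t - h 0) \<le> L * ((M + M) + (M + M))"
      using L[of t 0] t \<open>L \<ge> 0\<close> by (meson mult_left_mono order_refl order_trans)
    then show "norm x \<le> norm (h 0) + L * ((M + M) + (M + M))"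
      using norm_triangle_sub[of "h t" "h 0"] t by simp
  qed
  moreover have "slowly_oscillating 1 h"
    unfolding slowly_oscillating_def
  proof (intro allI impI)
    fix \<epsilon> :: real assume "0 < \<epsilon>"
    \<comment> \<open>The denominator is \<open>L + 1\<close> because \<open>L\<close> may be zero.\<close>
    define \<delta> where "\<delta> = \<epsilon> / (L + 1) / 2"
    have "\<delta> > 0" using \<open>0 < \<epsilon>\<close> \<open>L \<ge> 0\<close> by (simp add: \<delta>_def)
    then obtain T1 T2 where "T1 \<ge> 0"
      and T1: "\<And>u s. u \<ge> T1 \<Longrightarrow> s \<in> {0..1} \<Longrightarrow> norm (f (u + s) - f u) \<le> \<delta>"
      and T2: "\<And>u s. u \<ge> T2 \<Longrightarrow> s \<in> {0..1} \<Longrightarrow> norm (g (u + s) - g u) \<le> \<delta>"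
      using fE(4) gE(4) unfolding slowly_oscillating_def by meson
    have "norm (h (u + s) - h u) \<le> \<epsilon>" if "u \<ge> max T1 T2" "s \<in> {0..1}" for u s
    proof -
      have "norm (h (u + s) - h u) \<le> L * (norm (f (u + s) - f u) + norm (g (u + s) - g u))"
        using L that \<open>T1 \<ge> 0\<close> by simp
      also have "\<dots> \<le> L * (\<delta> + \<delta>)"
        using T1[of u s] T2[of u s] that \<open>L \<ge> 0\<close> by (intro mult_left_mono add_mono) auto
      also have "\<dots> \<le> (L + 1) * (\<delta> + \<delta>)"
        using \<open>\<delta> > 0\<close> by (intro mult_right_mono) auto
      also have "\<dots> = (L + 1) * (\<epsilon> / (L + 1))"
        unfolding \<delta>_def by (simp only: field_sum_of_halves)
      also have "\<dots> = \<epsilon>"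
        using \<open>L \<ge> 0\<close> by simp
      finally show ?thesis .
    qed
    then show "\<exists>T\<ge>0. \<forall>u\<ge>T. \<forall>s\<in>{0..1}. norm (h (u + s) - h u) \<le> \<epsilon>"
      using \<open>T1 \<ge> 0\<close> by (intro exI[of _ "max T1 T2"]) auto
  qed
  ultimately show ?thesis
    by (simp add: C_b_vv_iff[OF ab] C_b_def h_def)
qed

lemma C_b_vv_add:
  assumes ab: "0 \<le> a" "a < b" and fg: "f \<in> C_b_vv a b" "g \<in> C_b_vv a b"
  shows "(\<lambda>s\<in>{0..}. f s + g s) \<in> C_b_vv a b"
proof (rule C_b_vv_pointwise[OF ab fg compact_ops_add])
  have "norm (S + T - (S' + T')) \<le> 1 * (norm (S - S') + norm (T - T'))" for S S' T T' :: "'a \<Rightarrow>\<^sub>L 'a"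
    using norm_triangle_ineq[of "S - S'" "T - T'"] by (simp add: algebra_simps)
  then show "\<exists>L\<ge>0. \<forall>S\<in>compact_ops \<inter> cball 0 M. \<forall>S'\<in>compact_ops \<inter> cball 0 M.
      \<forall>T\<in>compact_ops \<inter> cball 0 M. \<forall>T'\<in>compact_ops \<inter> cball 0 M.
      norm (S + T - (S' + T' :: 'a \<Rightarrow>\<^sub>L 'a)) \<le> L * (norm (S - S') + norm (T - T'))" for M
    by (intro exI[of _ 1]) simp
qed

lemma C_b_vv_diff:
  assumes ab: "0 \<le> a" "a < b" and fg: "f \<in> C_b_vv a b" "g \<in> C_b_vv a b"
  shows "(\<lambda>s\<in>{0..}. f s - g s) \<in> C_b_vv a b"
proof (rule C_b_vv_pointwise[OF ab fg compact_ops_diff])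
  have "norm (S - T - (S' - T')) \<le> 1 * (norm (S - S') + norm (T - T'))" for S S' T T' :: "'a \<Rightarrow>\<^sub>L 'a"
    using norm_triangle_ineq4[of "S - S'" "T - T'"] by (simp add: algebra_simps)
  then show "\<exists>L\<ge>0. \<forall>S\<in>compact_ops \<inter> cball 0 M. \<forall>S'\<in>compact_ops \<inter> cball 0 M.
      \<forall>T\<in>compact_ops \<inter> cball 0 M. \<forall>T'\<in>compact_ops \<inter> cball 0 M.
      norm (S - T - (S' - T' :: 'a \<Rightarrow>\<^sub>L 'a)) \<le> L * (norm (S - S') + norm (T - T'))" for M
    by (intro exI[of _ 1]) simp
qed

lemma C_b_vv_mult:
  assumes ab: "0 \<le> a" "a < b" and fg: "f \<in> C_b_vv a b" "g \<in> C_b_vv a b"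
  shows "(\<lambda>s\<in>{0..}. f s o\<^sub>L g s) \<in> C_b_vv a b"
proof (rule C_b_vv_pointwise[OF ab fg])
  show "S o\<^sub>L T \<in> compact_ops" if "S \<in> compact_ops" "T \<in> compact_ops" for S T :: "'a \<Rightarrow>\<^sub>L 'a"
    using that compact_ops_compose_right compact_ops_linear by blast
  fix M :: real
  \<comment> \<open>The ball of radius \<open>M\<close> is empty if \<open>M < 0\<close>, but the constant must still be nonnegative.\<close>
  have "norm ((S o\<^sub>L T) - (S' o\<^sub>L T')) \<le> max 0 M * (norm (S - S') + norm (T - T'))"
    if "norm S' \<le> M" "norm T \<le> M" for S S' T T' :: "'a \<Rightarrow>\<^sub>L 'a"
  proof -
    have "(S o\<^sub>L T) - (S' o\<^sub>L T') = ((S - S') o\<^sub>L T) + (S' o\<^sub>L (T - T'))"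
      by (simp add: blinfun_eqI blinfun.bilinear_simps)
    also have "norm \<dots> \<le> norm (S - S') * norm T + norm S' * norm (T - T')"
      by (intro norm_triangle_mono norm_blinfun_compose)
    also have "\<dots> \<le> norm (S - S') * max 0 M + max 0 M * norm (T - T')"
      using that by (intro add_mono mult_left_mono mult_right_mono) auto
    finally show ?thesis by (simp add: algebra_simps)
  qed
  then show "\<exists>L\<ge>0. \<forall>S\<in>compact_ops \<inter> cball 0 M. \<forall>S'\<in>compact_ops \<inter> cball 0 M.
      \<forall>T\<in>compact_ops \<inter> cball 0 M. \<forall>T'\<in>compact_ops \<inter> cball 0 M.
      norm ((S o\<^sub>L T) - (S' o\<^sub>L (T' :: 'a \<Rightarrow>\<^sub>L 'a))) \<le> L * (norm (S - S') + norm (T - T'))"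
    by (intro exI[of _ "max 0 M"]) simp
qed

lemma op_scale_diff: "op_scale c S - op_scale c T = op_scale c (S - T)"
proof -
  have "op_scale c (S - T) + op_scale c T = op_scale c S"
    by (rule blinfun_eqI) (simp add: op_scale_apply blinfun.bilinear_simps scaleC_add_right[symmetric])
  then show ?thesis by (metis add_diff_cancel_right')
qed

lemma norm_op_scale_le: "norm (op_scale c T) \<le> cmod c * norm T"
proof (rule norm_blinfun_bound)
  show "norm (op_scale c T x) \<le> cmod c * norm T * norm x" for x
    using mult_left_mono[OF norm_blinfun[of T x], of "cmod c"]
    by (simp add: op_scale_apply norm_scaleC mult_ac)
qed simp

lemma C_b_vv_scale:
  assumes ab: "0 \<le> a" "a < b" and f: "f \<in> C_b_vv a b"
  shows "(\<lambda>s\<in>{0..}. op_scale c (f s)) \<in> C_b_vv a b"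
proof (rule C_b_vv_pointwise[OF ab f f, where p = "\<lambda>S T. op_scale c S"])
  have "norm (op_scale c S - op_scale c S') \<le> cmod c * (norm (S - S') + norm (T - T'))"
    for S S' T T' :: "'a \<Rightarrow>\<^sub>L 'a"
    using norm_op_scale_le[of c "S - S'"]
    by (simp add: op_scale_diff distrib_left add_increasing2)
  then show "\<exists>L\<ge>0. \<forall>S\<in>compact_ops \<inter> cball 0 M. \<forall>S'\<in>compact_ops \<inter> cball 0 M.
      \<forall>T\<in>compact_ops \<inter> cball 0 M. \<forall>T'\<in>compact_ops \<inter> cball 0 M.
      norm (op_scale c S - op_scale c (S' :: 'a \<Rightarrow>\<^sub>L 'a)) \<le> L * (norm (S - S') + norm (T - (T' :: 'a \<Rightarrow>\<^sub>L 'a)))" for M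
    by (intro exI[of _ "cmod c"]) simp
qed (rule compact_ops_scale)

lemma C_b_vv_star:
  assumes ab: "0 \<le> a" "a < b" and f: "f \<in> C_b_vv a b"
  shows "(\<lambda>s\<in>{0..}. op_adjoint (f s)) \<in> C_b_vv a b"
proof (rule C_b_vv_pointwise[OF ab f f, where p = "\<lambda>S T. op_adjoint S"])
  have "norm (op_adjoint S - op_adjoint S') \<le> 1 * (norm (S - S') + norm (T - T'))"
    if "S \<in> compact_ops" "S' \<in> compact_ops" for S S' T T' :: "'a \<Rightarrow>\<^sub>L 'a"
    using norm_adjoint_diff_le[OF that[THEN compact_ops_linear]] by (simp add: add_increasing2)
  then show "\<exists>L\<ge>0. \<forall>S\<in>compact_ops \<inter> cball 0 M. \<forall>S'\<in>compact_ops \<inter> cball 0 M.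
      \<forall>T\<in>compact_ops \<inter> cball 0 M. \<forall>T'\<in>compact_ops \<inter> cball 0 M.
      norm (op_adjoint S - op_adjoint (S' :: 'a \<Rightarrow>\<^sub>L 'a)) \<le> L * (norm (S - S') + norm (T - (T' :: 'a \<Rightarrow>\<^sub>L 'a)))" for M
    by (intro exI[of _ 1]) simp
qed (rule compact_ops_adjoint)

section \<open>Sampling and interpolation\<close>

lemma nat_floor_bounds:
  assumes "0 \<le> (t::real)"
  obtains n where "real n \<le> t" "t < real (Suc n)"
proof
  show "real (nat \<lfloor>t\<rfloor>) \<le> t" using assms by (rule of_nat_floor)
  show "t < real (Suc (nat \<lfloor>t\<rfloor>))" using assms by linarith
qed

definition interpolate :: "(nat \<Rightarrow> 'a::real_normed_vector) \<Rightarrow> real \<Rightarrow> 'a" where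
  "interpolate x t = (1 - frac t) *\<^sub>R x (nat \<lfloor>t\<rfloor>) + frac t *\<^sub>R x (Suc (nat \<lfloor>t\<rfloor>))"

lemma interpolate_of_nat [simp]: "interpolate x (real n) = x n"
  by (simp add: interpolate_def frac_def)

lemma interpolate_eq:
  assumes "real n \<le> t" "t \<le> real (Suc n)"
  shows "interpolate x t = (1 - (t - real n)) *\<^sub>R x n + (t - real n) *\<^sub>R x (Suc n)"
proof (cases "t = real (Suc n)")
  case True
  then show ?thesis using interpolate_of_nat[of x "Suc n"] by simp
next
  case False
  then have "\<lfloor>t\<rfloor> = int n"
    using assms by (intro floor_unique) auto
  then show ?thesis
    by (simp add: interpolate_def frac_def)
qed

lemma norm_interpolate_le:
  assumes "\<And>n. norm (x n) \<le> M"
  shows "norm (interpolate x t) \<le> M"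
proof -
  have "norm (interpolate x t) \<le> (1 - frac t) * norm (x (nat \<lfloor>t\<rfloor>)) + frac t * norm (x (Suc (nat \<lfloor>t\<rfloor>)))"
    unfolding interpolate_def using frac_ge_0[of t] frac_lt_1[of t]
    by (intro order_trans[OF norm_triangle_ineq]) simp
  also have "\<dots> \<le> (1 - frac t) * M + frac t * M"
    using assms frac_ge_0[of t] frac_lt_1[of t] by (intro add_mono mult_left_mono) auto
  finally show ?thesis by (simp add: algebra_simps)
qed

lemma norm_interpolate_diff_le:
  assumes "real n \<le> t" "t \<le> real (Suc n)"
  shows "norm (interpolate x t - x n) \<le> norm (x (Suc n) - x n)"
proof -
  have "interpolate x t - x n = (t - real n) *\<^sub>R (x (Suc n) - x n)"
    by (simp add: interpolate_eq[OF assms] algebra_simps)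
  then show ?thesis
    using assms mult_right_mono[of "t - real n" 1 "norm (x (Suc n) - x n)"] by simp
qed

text \<open>
  The affine pieces agree at the integers, hence paste to a continuous function on each
  initial segment, and continuity at a point only concerns a segment reaching beyond it.
\<close>

lemma continuous_on_interpolate: "continuous_on {0..} (interpolate x)"
proof -
  have piece: "continuous_on {real n..real (Suc n)} (interpolate x)" for n
  proof -
    have "continuous_on {real n..real (Suc n)}
        (\<lambda>t. (1 - (t - real n)) *\<^sub>R x n + (t - real n) *\<^sub>R x (Suc n))"
      by (intro continuous_intros)
    then show ?thesis
      by (rule continuous_on_eq) (simp add: interpolate_eq[of n])
  qed
  have initial: "continuous_on {0..real n} (interpolate x)" for n
  proof (induction n)
    case (Suc n)
    have "{0..real (Suc n)} = {0..real n} \<union> {real n..real (Suc n)}" by auto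
    then show ?case
      using continuous_on_closed_Un[OF _ _ Suc piece[of n]] by simp
  qed simp
  show ?thesis
    unfolding continuous_on_eq_continuous_within
  proof
    fix t :: real assume "t \<in> {0..}"
    obtain n where n: "t < real n" using reals_Archimedean2 by blast
    have "at t within {0..} = at t within {0..real n}"
      by (rule at_within_nhd[of t "{..<real n}"]) (use n in auto)
    then show "continuous (at t within {0..}) (interpolate x)"
      using initial[of n] n \<open>t \<in> {0..}\<close> by (simp add: continuous_on_eq_continuous_within)
  qed
qed

text \<open>
  Between \<open>u\<close> and \<open>u + s\<close> with \<open>s \<le> 1\<close> there is at most one integer. So going from
  \<open>interpolate x u\<close> to the sample on its left, on to the next sample if necessary, and then
  to \<open>interpolate x (u + s)\<close> costs at most three differences of consecutive samples.
\<close>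

lemma slowly_oscillating_interpolate:
  assumes "(\<lambda>i. norm (x (Suc i) - x i)) \<longlonglongrightarrow> 0"
  shows "slowly_oscillating 1 (interpolate x)"
  unfolding slowly_oscillating_def
proof (intro allI impI)
  fix \<epsilon> :: real assume "0 < \<epsilon>"
  then have "0 < \<epsilon> / 3" by simp
  then obtain N where N: "\<And>i. i \<ge> N \<Longrightarrow> norm (x (Suc i) - x i) < \<epsilon> / 3"
    using order_tendstoD(2)[OF assms] unfolding eventually_sequentially by blast
  have "norm (interpolate x (u + s) - interpolate x u) \<le> \<epsilon>"
    if us: "u \<ge> real N" "s \<in> {0..1}" for u s
  proof -
    obtain n where n: "real n \<le> u" "u < real (Suc n)"
      using nat_floor_bounds[of u] \<open>u \<ge> real N\<close> by auto
    obtain m where m: "real m \<le> u + s" "u + s < real (Suc m)"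
      using nat_floor_bounds[of "u + s"] us by auto
    have "N \<le> n" "m = n \<or> m = Suc n"
      using n m us by auto
    then have mn: "norm (x m - x n) \<le> \<epsilon> / 3"
      using N[of n] \<open>0 < \<epsilon>\<close> by auto
    have "norm (interpolate x (u + s) - x m) \<le> \<epsilon> / 3"
      using norm_interpolate_diff_le[of m "u + s" x] m N[of m] \<open>N \<le> n\<close> \<open>m = n \<or> m = Suc n\<close> by auto
    then have "norm (interpolate x (u + s) - x n) \<le> \<epsilon> / 3 + \<epsilon> / 3"
      using mn by (rule norm_diff_triangle_le)
    moreover have "norm (x n - interpolate x u) \<le> \<epsilon> / 3"
      using norm_interpolate_diff_le[of n u x] n N[of n] \<open>N \<le> n\<close> by (auto simp: norm_minus_commute)
    ultimately have "norm (interpolate x (u + s) - interpolate x u) \<le> \<epsilon> / 3 + \<epsilon> / 3 + \<epsilon> / 3"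
      by (rule norm_diff_triangle_le)
    then show ?thesis by simp
  qed
  then show "\<exists>T\<ge>0. \<forall>u\<ge>T. \<forall>s\<in>{0..1}. norm (interpolate x (u + s) - interpolate x u) \<le> \<epsilon>"
    by (intro exI[of _ "real N"]) auto
qed

lemma interpolate_C_b_vv:
  assumes ab: "0 \<le> a" "a < b" and x: "x \<in> B_infty"
  shows "(\<lambda>t\<in>{0..}. interpolate x t) \<in> C_b_vv a b"
proof -
  have "slowly_oscillating 1 (\<lambda>t\<in>{0..}. interpolate x t)"
    by (rule slowly_oscillating_cong[OF slowly_oscillating_interpolate[of x]])
      (use x in \<open>auto simp: B_infty_def\<close>)
  moreover obtain M where M: "\<And>n. norm (x n) \<le> M"
    using x by (auto simp: B_infty_def bounded_iff)
  have "bounded (restrict (interpolate x) {0..} ` {0..})"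
    using norm_interpolate_le[of x M] M by (auto simp: bounded_iff)
  moreover have "continuous_on {0..} (restrict (interpolate x) {0..})"
    using continuous_on_interpolate[of x] by (rule continuous_on_eq) simp
  moreover have "interpolate x t \<in> compact_ops" for t
    using x unfolding interpolate_def B_infty_def
    by (intro compact_ops_add compact_ops_scaleR) auto
  ultimately show ?thesis
    by (simp add: C_b_vv_iff[OF ab] C_b_def)
qed

definition sample :: "(real \<Rightarrow> 'a) \<Rightarrow> nat \<Rightarrow> 'a" where
  "sample f n = f (real n)"

lemma sample_B_infty:
  assumes ab: "0 \<le> a" "a < b" and f: "f \<in> C_b_vv a b"
  shows "sample f \<in> B_infty"
proof -
  have fE: "f \<in> {0..} \<rightarrow>\<^sub>E compact_ops" "bounded (f ` {0..})" "slowly_oscillating 1 f"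
    using f by (auto simp: C_b_vv_iff[OF ab] C_b_def)
  have "(\<lambda>i. norm (sample f (Suc i) - sample f i)) \<longlonglongrightarrow> 0"
  proof (rule LIMSEQ_I)
    fix \<epsilon> :: real assume "0 < \<epsilon>"
    then obtain T where T: "\<And>u s. u \<ge> T \<Longrightarrow> s \<in> {0..1} \<Longrightarrow> norm (f (u + s) - f u) \<le> \<epsilon> / 2"
      using fE(3) unfolding slowly_oscillating_def by (meson half_gt_zero)
    obtain N where N: "T \<le> real N" using real_arch_simple by blast
    have "norm (norm (sample f (Suc i) - sample f i) - 0) < \<epsilon>" if "i \<ge> N" for i
      using T[of "real i" 1] N that \<open>0 < \<epsilon>\<close> by (simp add: sample_def add.commute)
    then show "\<exists>N. \<forall>i\<ge>N. norm (norm (sample f (Suc i) - sample f i) - 0) < \<epsilon>" by blast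
  qed
  moreover have "bounded (range (sample f))"
    using fE(2) by (rule bounded_subset) (auto simp: sample_def)
  ultimately show ?thesis
    using fE(1) by (auto simp: B_infty_def sample_def PiE_iff)
qed

text \<open>
  Each \<open>t\<close> lies within distance 1 of an integer, so slow oscillation carries decay at the
  integers over to all large \<open>t\<close>.
\<close>

lemma C_0_iff_sample_null:
  assumes ab: "0 \<le> a" "a < b" and f: "f \<in> C_b_vv a b"
  shows "f \<in> C_0 \<longleftrightarrow> sample f \<in> I_infty"
proof
  assume "f \<in> C_0"
  then have "((\<lambda>t. norm (f t)) \<longlongrightarrow> 0) at_top" by (simp add: C_0_def)
  then have "(\<lambda>n. norm (f (real n))) \<longlonglongrightarrow> 0"
    by (rule filterlim_compose[OF _ filterlim_real_sequentially])
  then show "sample f \<in> I_infty"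
    using sample_B_infty[OF ab f] by (simp add: I_infty_def sample_def)
next
  assume "sample f \<in> I_infty"
  then have lim: "(\<lambda>n. norm (f (real n))) \<longlonglongrightarrow> 0"
    by (simp add: I_infty_def sample_def)
  have fE: "f \<in> {0..} \<rightarrow>\<^sub>E compact_ops" "continuous_on {0..} f" "slowly_oscillating 1 f"
    using f by (auto simp: C_b_vv_iff[OF ab] C_b_def)
  have "((\<lambda>t. norm (f t)) \<longlongrightarrow> 0) at_top"
  proof (rule tendstoI)
    fix \<epsilon> :: real assume "0 < \<epsilon>"
    then obtain T where "T \<ge> 0"
      and T: "\<And>u s. u \<ge> T \<Longrightarrow> s \<in> {0..1} \<Longrightarrow> norm (f (u + s) - f u) \<le> \<epsilon> / 2"
      using fE(3) unfolding slowly_oscillating_def by (meson half_gt_zero)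
    obtain N where N: "\<And>n. n \<ge> N \<Longrightarrow> norm (f (real n)) < \<epsilon> / 2"
      using order_tendstoD(2)[OF lim, of "\<epsilon> / 2"] \<open>0 < \<epsilon>\<close> unfolding eventually_sequentially by auto
    have "dist (norm (f t)) 0 < \<epsilon>" if t: "t \<ge> T + 1 + real N" for t
    proof -
      obtain n where n: "real n \<le> t" "t < real (Suc n)"
        using nat_floor_bounds[of t] t \<open>T \<ge> 0\<close> by auto
      have "norm (f t - f (real n)) \<le> \<epsilon> / 2"
        using T[of "real n" "t - real n"] n t by auto
      moreover have "norm (f (real n)) < \<epsilon> / 2"
        using N[of n] n t \<open>T \<ge> 0\<close> by auto
      ultimately show ?thesis
        using norm_triangle_sub[of "f t" "f (real n)"] by simp
    qed
    then show "\<forall>\<^sub>F t in at_top. dist (norm (f t)) 0 < \<epsilon>"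
      unfolding eventually_at_top_linorder by blast
  qed
  then show "f \<in> C_0"
    using fE by (simp add: C_0_def)
qed

section \<open>The induced isomorphism\<close>

text \<open>
  If the samples of \<open>f\<close> and \<open>h\<close> differ by a null sequence, then \<open>f - h\<close> is an element of
  \<^term>\<open>C_b_vv a b\<close> with null samples, so it vanishes at infinity.
\<close>

lemma sample_coset:
  assumes ab: "0 \<le> a" "a < b" and h: "h \<in> C_b_vv a b"
  shows "{f \<in> C_b_vv a b. sample f \<in> cs_coset (fun_algebra UNIV B_infty) I_infty (sample h)}
    = cs_coset (fun_algebra {0..} (C_b_vv a b)) C_0 h"
proof (intro equalityI subsetI)
  fix f assume "f \<in> {f \<in> C_b_vv a b. sample f \<in> cs_coset (fun_algebra UNIV B_infty) I_infty (sample h)}"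
  then obtain i where f: "f \<in> C_b_vv a b" and i: "i \<in> I_infty" "sample f = (\<lambda>n\<in>UNIV. sample h n + i n)"
    by (auto simp: cs_coset_def fun_algebra_def)
  define j where "j = (\<lambda>s\<in>{0..}. f s - h s)"
  have "j \<in> C_b_vv a b"
    unfolding j_def by (rule C_b_vv_diff[OF ab f h])
  moreover have "sample j = i"
  proof
    fix n
    show "sample j n = i n"
      using fun_cong[OF i(2), of n] by (simp add: j_def sample_def)
  qed
  ultimately have "j \<in> C_0"
    using C_0_iff_sample_null[OF ab, of j] i(1) by simp
  moreover have "f = (\<lambda>s\<in>{0..}. h s + j s)"
    using f by (auto simp: j_def C_b_vv_def C_b_def PiE_iff extensional_def fun_eq_iff)
  ultimately show "f \<in> cs_coset (fun_algebra {0..} (C_b_vv a b)) C_0 h"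
    by (auto simp: cs_coset_def fun_algebra_def)
next
  fix f assume "f \<in> cs_coset (fun_algebra {0..} (C_b_vv a b)) C_0 h"
  then obtain j where j: "j \<in> C_0" "f = (\<lambda>s\<in>{0..}. h s + j s)"
    by (auto simp: cs_coset_def fun_algebra_def)
  have jC: "j \<in> C_b_vv a b"
    using C_0_subset_C_b_vv[OF ab] j(1) by blast
  then have "sample j \<in> I_infty"
    using C_0_iff_sample_null[OF ab] j(1) by blast
  moreover have "sample f = (\<lambda>n\<in>UNIV. sample h n + sample j n)"
    by (simp add: j(2) sample_def fun_eq_iff)
  ultimately show "f \<in> {f \<in> C_b_vv a b. sample f \<in> cs_coset (fun_algebra UNIV B_infty) I_infty (sample h)}"
    using C_b_vv_add[OF ab h jC] j(2) by (auto simp: cs_coset_def fun_algebra_def)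
qed

theorem lemma4p1:
  fixes a b :: real
  assumes "separable TYPE('h::complex_hilbert_space)"
    and "infinite_dimensional TYPE('h)"
    and "0 \<le> a" and "a < b"
  shows "cstar_isomorphic
           (Q_infty :: (nat \<Rightarrow> ('h \<Rightarrow>\<^sub>L 'h)) set cstar_struct)
           (Q_b_vv a b :: (real \<Rightarrow> ('h \<Rightarrow>\<^sub>L 'h)) set cstar_struct)"
proof -
  note ab = \<open>0 \<le> a\<close> \<open>a < b\<close>
  let ?A = "fun_algebra UNIV B_infty :: (nat \<Rightarrow> ('h \<Rightarrow>\<^sub>L 'h)) cstar_struct"
  let ?B = "fun_algebra {0..} (C_b_vv a b) :: (real \<Rightarrow> ('h \<Rightarrow>\<^sub>L 'h)) cstar_struct"
  have bdd_B: "bdd_above ((\<lambda>s. norm (f s)) ` {0..})" if "f \<in> C_b_vv a b" for f :: "real \<Rightarrow> ('h \<Rightarrow>\<^sub>L 'h)"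
    using that by (auto simp: C_b_vv_def C_b_def bounded_iff intro: bdd_aboveI2)
  have bdd_A: "bdd_above (range (\<lambda>n. norm (x n)))" if "x \<in> B_infty" for x :: "nat \<Rightarrow> ('h \<Rightarrow>\<^sub>L 'h)"
    using that by (auto simp: B_infty_def bounded_iff intro: bdd_aboveI2)
  show ?thesis
    unfolding Q_infty_def Q_b_vv_def
  proof (rule cstar_isomorphic_quotients[where \<rho> = sample])
    fix f g assume fg: "f \<in> cs_carrier ?B" "g \<in> cs_carrier ?B"
    show "cs_add ?B f g \<in> cs_carrier ?B \<and> sample (cs_add ?B f g) = cs_add ?A (sample f) (sample g)"
      using C_b_vv_add[OF ab] fg by (auto simp: fun_algebra_def sample_def fun_eq_iff)
    show "cs_mult ?B f g \<in> cs_carrier ?B \<and> sample (cs_mult ?B f g) = cs_mult ?A (sample f) (sample g)"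
      using C_b_vv_mult[OF ab] fg by (auto simp: fun_algebra_def sample_def fun_eq_iff)
  next
    fix f c assume f: "f \<in> cs_carrier ?B"
    then have f': "f \<in> C_b_vv a b" by (simp add: fun_algebra_def)
    show "sample f \<in> cs_carrier ?A"
      using sample_B_infty[OF ab f'] by (simp add: fun_algebra_def)
    show "cs_scale ?B c f \<in> cs_carrier ?B \<and> sample (cs_scale ?B c f) = cs_scale ?A c (sample f)"
      using C_b_vv_scale[OF ab f'] by (auto simp: fun_algebra_def sample_def fun_eq_iff)
    show "cs_star ?B f \<in> cs_carrier ?B \<and> sample (cs_star ?B f) = cs_star ?A (sample f)"
      using C_b_vv_star[OF ab f'] by (auto simp: fun_algebra_def sample_def fun_eq_iff)
    show "cs_norm ?A (sample f) \<le> cs_norm ?B f"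
      unfolding fun_algebra_def cstar_struct.simps
      by (rule cSUP_least) (auto simp: sample_def intro: cSUP_upper[OF _ bdd_B[OF f']])
    show "{f' \<in> cs_carrier ?B. sample f' \<in> cs_coset ?A I_infty (sample f)} = cs_coset ?B C_0 f"
      using sample_coset[OF ab f'] by (simp add: fun_algebra_def)
  next
    fix x assume "x \<in> cs_carrier ?A"
    then have x: "x \<in> B_infty" by (simp add: fun_algebra_def)
    have upper: "norm (x n) \<le> cs_norm ?A x" for n
      unfolding fun_algebra_def cstar_struct.simps by (rule cSUP_upper[OF _ bdd_A[OF x]]) simp
    show "0 \<le> cs_norm ?A x"
      using upper[of 0] norm_ge_zero order_trans by blast
    let ?f = "\<lambda>t\<in>{0..}. interpolate x t"
    have "cs_norm ?B ?f \<le> cs_norm ?A x"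
      unfolding fun_algebra_def[of "{0..}"] cstar_struct.simps
      by (rule cSUP_least) (auto intro: norm_interpolate_le upper)
    then show "\<exists>f\<in>cs_carrier ?B. sample f = x \<and> cs_norm ?B f \<le> cs_norm ?A x"
      using interpolate_C_b_vv[OF ab x]
      by (intro bexI[of _ ?f]) (auto simp: sample_def fun_eq_iff fun_algebra_def)
  qed (auto simp: fun_algebra_def I_infty_def)
qed

end
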